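(* Fix $t\in[0,1]$ and let $\mathcal X:=[0,1]\times[0,\infty)$. For each $n\ge1$ let $T_{(1)}\le\dots\le T_{(n)}$ be the order statistics of $n$ independent random variables uniformly distributed on $[0,1]$, $T_{(0)}:=0$, and let $\nu_1,\nu_2,\dots$ be i.i.d. nonnegative random variables, independent of the order statistics, with $\mathbb P(\nu_1>0)=1$, mean $1/\mu$ and cumulant generating function $\varphi(\theta)=\log\mathbb E[e^{\theta\nu_1}]$, such that $0$ lies in the interior of $\mathbb D:=\{\theta\in\mathbb R:\varphi(\theta)<\infty\}$. Let $$X^n(t):=S^n(t)-T^n(t),\qquad S^n(t):=\frac1n\sum_{i=1}^{\lfloor nt\rfloor}\nu_i,\qquad T^n(t):=T_{(\lfloor nt\rfloor)}.$$ Then the sequence of random variables $\{X^n(t),\ n\ge1\}$ satisfies the large deviations principle (LDP) with good rate function $$J_t(y)=\inf_{\{x=(x_1,x_2)\in\mathcal X:\ x_1=x_2+y\}}\big(I_t(x_1)+\Lambda_t^*(x_2)\big),\qquad y\in\mathbb R,$$ where $I_t(x)=t\log\left(\frac tx\right)+(1-t)\log\left(\frac{1-t}{1-x}\right)$ and $\Lambda_t^*(x)=\sup_{\theta\in\mathbb R}\{\theta x-t\varphi(\theta)\}$.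
   Context: A rate function on a Hausdorff topological space $\mathcal Y$ is a lower semicontinuous map $I:\mathcal Y\to[0,\infty]$; it is good if all its level sets $\{x: I(x)\le\alpha\}$, $\alpha\in[0,\infty)$, are compact. A sequence of random elements $\{X_n\}$ of $\mathcal Y$ satisfies the LDP with rate function $I$ if $\liminf_{n\to\infty}\frac1n\log\mathbb P(X_n\in G)\ge-\inf_{x\in G}I(x)$ for every open $G\subset\mathcal Y$ and $\limsup_{n\to\infty}\frac1n\log\mathbb P(X_n\in F)\le-\inf_{x\in F}I(x)$ for every closed $F\subset\mathcal Y$. Here $\mathcal Y=\mathbb R$. Conventions: in $I_t$ a term with zero coefficient is $0$ and a term $c\log(c/0)$ with $c>0$ is $+\infty$; $0\cdot\infty=0$; the infimum over the empty set is $+\infty$.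
   Formalization: The constraint x_1 = x_2 + y in J_t is corrected to x_2 = x_1 + y, since X^n = S^n − T^n (the printed sign fails, e.g. for ν_i = 2, t = 1/2), and t = 0 is excluded, because there X^n(0) = 0 while J_0 is finite on an interval, so the lower bound fails. *)

theory Defs
  imports "HOL-Probability.Probability"
begin

section \<open>Large deviations principle\<close>

text \<open>Logarithm from \<open>[0,\<infinity>]\<close> to \<open>[-\<infinity>,\<infinity>]\<close>: the library's \<open>ln\<close> is total on the reals with
  \<open>ln 0 = 0\<close>, which would be wrong for events of probability zero.\<close>

definition ext_ln :: "ennreal \<Rightarrow> ereal" where
  "ext_ln p = (if p = 0 then -\<infinity> else if p = \<top> then \<infinity> else ereal (ln (enn2real p)))"

definition rate_function :: "('b::t2_space \<Rightarrow> ereal) \<Rightarrow> bool" where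
  "rate_function I \<longleftrightarrow> (\<forall>x. 0 \<le> I x) \<and> (\<forall>\<alpha>. closed {x. I x \<le> \<alpha>})"

definition good_rate_function :: "('b::t2_space \<Rightarrow> ereal) \<Rightarrow> bool" where
  "good_rate_function I \<longleftrightarrow>
     rate_function I \<and> (\<forall>\<alpha>::real. 0 \<le> \<alpha> \<longrightarrow> compact {x. I x \<le> ereal \<alpha>})"

text \<open>The sequence is indexed by \<open>n \<ge> 1\<close>; the entry \<open>X 0\<close> is irrelevant.\<close>

definition satisfies_LDP ::
  "'a measure \<Rightarrow> (nat \<Rightarrow> 'a \<Rightarrow> 'b::t2_space) \<Rightarrow> ('b \<Rightarrow> ereal) \<Rightarrow> bool" where
  "satisfies_LDP M X I \<longleftrightarrow>
     rate_function I \<and>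
     (\<forall>n\<ge>1. X n \<in> borel_measurable M) \<and>
     (\<forall>G. open G \<longrightarrow>
        liminf (\<lambda>n. ereal (1 / real n) * ext_ln (emeasure M {\<omega> \<in> space M. X n \<omega> \<in> G}))
          \<ge> - (INF x\<in>G. I x)) \<and>
     (\<forall>F. closed F \<longrightarrow>
        limsup (\<lambda>n. ereal (1 / real n) * ext_ln (emeasure M {\<omega> \<in> space M. X n \<omega> \<in> F}))
          \<le> - (INF x\<in>F. I x))"

section \<open>The processes\<close>

text \<open>\<open>k\<close>-th smallest of \<open>u 1, \<dots>, u n\<close> for \<open>1 \<le> k \<le> n\<close>, with value \<open>0\<close> for \<open>k = 0\<close>.\<close>

definition order_stat :: "(nat \<Rightarrow> real) \<Rightarrow> nat \<Rightarrow> nat \<Rightarrow> real" where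
  "order_stat u n k = (if k = 0 then 0 else sort (map u [1..<Suc n]) ! (k - 1))"

definition T_proc :: "(nat \<Rightarrow> nat \<Rightarrow> 'a \<Rightarrow> real) \<Rightarrow> real \<Rightarrow> nat \<Rightarrow> 'a \<Rightarrow> real" where
  "T_proc U t n \<omega> = order_stat (\<lambda>i. U n i \<omega>) n (nat \<lfloor>real n * t\<rfloor>)"

definition S_proc :: "(nat \<Rightarrow> 'a \<Rightarrow> real) \<Rightarrow> real \<Rightarrow> nat \<Rightarrow> 'a \<Rightarrow> real" where
  "S_proc \<nu> t n \<omega> = (1 / real n) * (\<Sum>i = 1..nat \<lfloor>real n * t\<rfloor>. \<nu> i \<omega>)"

definition X_proc ::
  "(nat \<Rightarrow> nat \<Rightarrow> 'a \<Rightarrow> real) \<Rightarrow> (nat \<Rightarrow> 'a \<Rightarrow> real) \<Rightarrow> real \<Rightarrow> nat \<Rightarrow> 'a \<Rightarrow> real" where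
  "X_proc U \<nu> t n \<omega> = S_proc \<nu> t n \<omega> - T_proc U t n \<omega>"

section \<open>The rate functions\<close>

definition cgf :: "'a measure \<Rightarrow> ('a \<Rightarrow> real) \<Rightarrow> real \<Rightarrow> ereal" where
  "cgf M Z \<theta> = ext_ln (\<integral>\<^sup>+\<omega>. ennreal (exp (\<theta> * Z \<omega>)) \<partial>M)"

text \<open>\<open>c log (c / d)\<close> with the conventions \<open>0 log (0 / d) = 0\<close> and \<open>c log (c / 0) = \<infinity>\<close> for \<open>c > 0\<close>.\<close>

definition xlog_ratio :: "real \<Rightarrow> real \<Rightarrow> ereal" where
  "xlog_ratio c d = (if c = 0 then 0 else if d = 0 then \<infinity> else ereal (c * ln (c / d)))"

text \<open>Meaningful only for \<open>t\<close> and \<open>x\<close> in \<open>[0,1]\<close>.\<close>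

definition I_rate :: "real \<Rightarrow> real \<Rightarrow> ereal" where
  "I_rate t x = xlog_ratio t x + xlog_ratio (1 - t) (1 - x)"

definition Lambda_star :: "(real \<Rightarrow> ereal) \<Rightarrow> real \<Rightarrow> real \<Rightarrow> ereal" where
  "Lambda_star \<phi> t x = (SUP \<theta>. ereal (\<theta> * x) - ereal t * \<phi> \<theta>)"

text \<open>The coordinates \<open>x1\<close> and \<open>x2\<close> stand for the values of \<open>T_proc\<close> and \<open>S_proc\<close>. Since \<open>X_proc\<close>
  is \<open>S_proc - T_proc\<close>, the constraint is \<open>y = x2 - x1\<close>; the relation \<open>x1 = x2 + y\<close> found in the
  source describes \<open>T_proc - S_proc\<close> instead.\<close>

definition J_rate :: "(real \<Rightarrow> ereal) \<Rightarrow> real \<Rightarrow> real \<Rightarrow> ereal" where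
  "J_rate \<phi> t y =
     (INF (x1, x2) \<in> {(x1, x2) \<in> {0..1} \<times> {0..}. x2 = x1 + y}.
        I_rate t x1 + Lambda_star \<phi> t x2)"

end

(* A large deviations principle on a metric space follows from three local facts: small neighbourhoods
   of x have probability at most exp (- n r) for r < I x, all neighbourhoods have probability at least
   exp (- n r) for r > I x, and the sequence is exponentially tight. In this form lower semicontinuity
   and goodness of I come for free, and the local bounds pass to independent pairs and continuous images;
   the map (x1, x2) |-> x2 - x1 then gives J.

   For the order statistics: T_(k) lies in (a, b) only if some k of the uniform variables are below b and
   the others above a, which has probability at most C(n, k) b^k (1 - a)^(n - k), and there is a matching
   lower bound. The rate is read off ln C(n, k) / n.

   For the partial sums: the upper bounds are Chernoff's. The lower bound is Cramer's, proved without a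
   change of measure: truncate, minimise the truncated moment generating function m at theta, and split
   m(theta)^k according to whether the centred sum is below k delta in absolute value. As m is flat at its
   minimum, Chernoff's bounds at theta +- eta make the complementary part exponentially smaller. *)

theory Submission
  imports Defs
begin

section \<open>Local large deviation bounds\<close>

text \<open>The restriction \<open>0 < t\<close> is forced: for \<open>t = 0\<close> the process is
  identically 0, while \<open>J_rate\<close> equals \<open>- ln (1 + y)\<close> for
  \<open>-1 < y\<close> and \<open>y \<le> 0\<close>, so the lower bound fails on nonempty open
  subsets of (-1, 0). Bounding probabilities by exponentials with a real exponent avoids logarithms
  of zero and arithmetic with infinite rates: if \<open>I x\<close> is infinite, every r qualifies
  for the upper bound and none for the lower one. The inequalities between r and \<open>I x\<close>
  are strict, and the slack they leave absorbs the constant factors of union bounds. For the partial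
  sums the obstacle is that the generating function may be infinite on part of the line, so that its
  infimum may be missed or attained at the boundary of the domain, where there is no derivative to
  set to zero. The truncated function is finite and continuous everywhere, and a quadratic estimate
  around its minimum is all that is used. The condition on the interior of the domain supplies a
  positive argument with finite generating function, which yields exponential tightness.\<close>

definition local_LDP :: "'a measure \<Rightarrow> (nat \<Rightarrow> 'a \<Rightarrow> 'b::t2_space) \<Rightarrow> ('b \<Rightarrow> ereal) \<Rightarrow> bool" where
  "local_LDP M Y I \<longleftrightarrow>
     (\<forall>n\<ge>1. Y n \<in> borel_measurable M) \<and>
     (\<forall>x r. ereal r < I x \<longrightarrow> (\<exists>A. open A \<and> x \<in> A \<and>
        (\<forall>\<^sub>F n in sequentially. measure M {\<omega> \<in> space M. Y n \<omega> \<in> A} \<le> exp (- (r * real n))))) \<and>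
     (\<forall>x r A. I x < ereal r \<longrightarrow> open A \<longrightarrow> x \<in> A \<longrightarrow>
        (\<forall>\<^sub>F n in sequentially. exp (- (r * real n)) \<le> measure M {\<omega> \<in> space M. Y n \<omega> \<in> A})) \<and>
     (\<forall>r. \<exists>K. compact K \<and>
        (\<forall>\<^sub>F n in sequentially. measure M {\<omega> \<in> space M. Y n \<omega> \<notin> K} \<le> exp (- (r * real n))))"

lemma local_LDP_measurable:
  "local_LDP M Y I \<Longrightarrow> 1 \<le> n \<Longrightarrow> Y n \<in> borel_measurable M"
  by (auto simp: local_LDP_def)

lemma local_LDP_upper:
  assumes "local_LDP M Y I" "ereal r < I x"
  obtains A where "open A" "x \<in> A"
    "\<forall>\<^sub>F n in sequentially. measure M {\<omega> \<in> space M. Y n \<omega> \<in> A} \<le> exp (- (r * real n))"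
  using assms(1)[unfolded local_LDP_def, THEN conjunct2, THEN conjunct1, rule_format, OF assms(2)]
  by blast

lemma local_LDP_lower:
  assumes "local_LDP M Y I" "I x < ereal r" "open A" "x \<in> A"
  shows "\<forall>\<^sub>F n in sequentially. exp (- (r * real n)) \<le> measure M {\<omega> \<in> space M. Y n \<omega> \<in> A}"
  using assms(1)[unfolded local_LDP_def, THEN conjunct2, THEN conjunct2, THEN conjunct1, rule_format,
      OF assms(2-4)] .

lemma local_LDP_tight:
  assumes "local_LDP M Y I"
  obtains K where "compact K"
    "\<forall>\<^sub>F n in sequentially. measure M {\<omega> \<in> space M. Y n \<omega> \<notin> K} \<le> exp (- (r * real n))"
  using assms[unfolded local_LDP_def, THEN conjunct2, THEN conjunct2, THEN conjunct2, rule_format, of r]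
  by blast

text \<open>The gap between the rates contributes a factor \<open>exp ((s - r) * n)\<close>, which
  outgrows any constant. This pays for the number of events in each union bound.\<close>

lemma eventually_mult_exp_le:
  fixes c r s :: real
  assumes "r < s"
  shows "\<forall>\<^sub>F n in sequentially. c * exp (- (s * real n)) \<le> exp (- (r * real n))"
proof -
  have "filterlim (\<lambda>n. (s - r) * real n) at_top sequentially"
    using assms
    by (intro filterlim_tendsto_pos_mult_at_top[OF tendsto_const] filterlim_real_sequentially) auto
  \<comment> \<open>The maximum with 1 keeps the logarithm meaningful when \<open>c\<close> is not
    positive.\<close>
  then have "\<forall>\<^sub>F n in sequentially. ln (max c 1) \<le> (s - r) * real n"
    by (simp add: filterlim_at_top)
  then show ?thesis
  proof eventually_elim
    case (elim n)
    have "c \<le> exp (ln (max c 1))" by simp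
    also have "\<dots> \<le> exp ((s - r) * real n)" using elim by (simp only: exp_le_cancel_iff)
    finally have "c * exp (- (s * real n)) \<le> exp ((s - r) * real n) * exp (- (s * real n))"
      by (intro mult_right_mono) auto
    also have "\<dots> = exp (- (r * real n))"
      by (simp add: mult_exp_exp algebra_simps)
    finally show ?case .
  qed
qed

text \<open>The source of nonnegativity, lower semicontinuity and compact level sets: in each case a
  violation would give one event two incompatible exponential bounds.\<close>

lemma eventually_exp_bounds_False:
  fixes r s :: real and p :: "nat \<Rightarrow> real"
  assumes "r < s"
    and "\<forall>\<^sub>F n in sequentially. exp (- (r * real n)) \<le> p n"
    and "\<forall>\<^sub>F n in sequentially. p n \<le> exp (- (s * real n))"
  shows False
proof -
  have "\<forall>\<^sub>F n in sequentially. False"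
    \<comment> \<open>The factor 2 makes the resulting chain of inequalities absurd for a single
      \<open>n\<close>.\<close>
    using eventually_mult_exp_le[OF assms(1), of 2] assms(2,3)
  proof eventually_elim
    case (elim n)
    then have "2 * exp (- (s * real n)) \<le> exp (- (s * real n))" by linarith
    then show False by simp
  qed
  then show False by simp
qed

lemma ext_ln_ge:
  assumes "1 \<le> n" "exp (- (r * real n)) \<le> p"
  shows "ereal (- r) \<le> ereal (1 / real n) * ext_ln (ennreal p)"
proof -
  have "0 < p" using assms(2) exp_gt_zero less_le_trans by blast
  then have "- (r * real n) \<le> ln p" using assms(2) by (simp add: ln_ge_iff)
  then show ?thesis
    using assms(1) \<open>0 < p\<close> by (simp add: ext_ln_def field_simps)
qed

lemma ext_ln_le:
  assumes "1 \<le> n" "p \<le> exp (- (r * real n))"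
  shows "ereal (1 / real n) * ext_ln (ennreal p) \<le> ereal (- r)"
proof (cases "p \<le> 0")
  case True
  then show ?thesis using assms(1) by (simp add: ext_ln_def ennreal_neg)
next
  case False
  then have "ln p \<le> - (r * real n)"
    using assms(2) by (metis ln_exp ln_le_cancel_iff exp_gt_zero not_le)
  then show ?thesis
    using assms(1) False by (simp add: ext_ln_def field_simps)
qed

section \<open>From local bounds to the large deviations principle\<close>

context prob_space
begin

text \<open>Exponential tightness replaces \<open>F\<close> by the compact set
  \<open>F \<inter> K\<close>, and finitely many of the small neighbourhoods cover it.\<close>

lemma local_LDP_closed_bound:
  fixes Y :: "nat \<Rightarrow> 'a \<Rightarrow> 'b::metric_space"
  assumes Y: "local_LDP M Y I" and "closed F" and "r < s" and F: "\<And>x. x \<in> F \<Longrightarrow> ereal s \<le> I x"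
  shows "\<forall>\<^sub>F n in sequentially. prob {\<omega> \<in> space M. Y n \<omega> \<in> F} \<le> exp (- (r * real n))"
proof -
  \<comment> \<open>The level \<open>u\<close> lies strictly below \<open>s\<close>, as the local
    upper bound needs a strict inequality, and strictly above \<open>r\<close>, to absorb the factor
    \<open>1 + card C\<close> of the union bound.\<close>
  obtain u where u: "r < u" "u < s" using dense[OF \<open>r < s\<close>] by blast
  obtain K where K: "compact K"
      "\<forall>\<^sub>F n in sequentially. prob {\<omega> \<in> space M. Y n \<omega> \<notin> K} \<le> exp (- (u * real n))"
    using local_LDP_tight[OF Y] .
  have "\<exists>A. open A \<and> x \<in> A \<and>
      (\<forall>\<^sub>F n in sequentially. prob {\<omega> \<in> space M. Y n \<omega> \<in> A} \<le> exp (- (u * real n)))"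
    if "x \<in> F \<inter> K" for x
  proof -
    have "ereal u < ereal s" "ereal s \<le> I x" using F[of x] that u by auto
    then have "ereal u < I x" by (rule less_le_trans)
    from local_LDP_upper[OF Y this] show ?thesis by blast
  qed
  then have "\<forall>x\<in>F \<inter> K. \<exists>A. open A \<and> x \<in> A \<and>
      (\<forall>\<^sub>F n in sequentially. prob {\<omega> \<in> space M. Y n \<omega> \<in> A} \<le> exp (- (u * real n)))" ..
  from bchoice[OF this] obtain A where A: "\<forall>x\<in>F \<inter> K. open (A x) \<and> x \<in> A x \<and>
      (\<forall>\<^sub>F n in sequentially. prob {\<omega> \<in> space M. Y n \<omega> \<in> A x} \<le> exp (- (u * real n)))"
    ..
  have "compact (F \<inter> K)" using K \<open>closed F\<close> by (simp add: closed_Int_compact)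
  then obtain C where C: "C \<subseteq> F \<inter> K" "finite C" "F \<inter> K \<subseteq> (\<Union>c\<in>C. A c)"
    using A by (elim compactE_image[of _ "F \<inter> K" A]) auto
  have ev: "\<forall>\<^sub>F n in sequentially. \<forall>c\<in>C. prob {\<omega> \<in> space M. Y n \<omega> \<in> A c} \<le> exp (- (u * real n))"
    using C A by (intro eventually_ball_finite) auto
  show ?thesis
    using ev K(2) eventually_ge_at_top[of 1] eventually_mult_exp_le[OF u(1), of "1 + real (card C)"]
  proof eventually_elim
    case (elim n)
    have [measurable]: "Y n \<in> borel_measurable M" using local_LDP_measurable[OF Y] elim by blast
    have [measurable]: "A c \<in> sets borel" if "c \<in> C" for c
      using A C(1) that by (intro borel_open) blast
    have [measurable]: "K \<in> sets borel" using K by (simp add: borel_compact)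
    have mA: "{\<omega> \<in> space M. Y n \<omega> \<in> A c} \<in> sets M" if "c \<in> C" for c
      using that by measurable
    have mK: "{\<omega> \<in> space M. Y n \<omega> \<notin> K} \<in> sets M" by measurable
    have "prob {\<omega> \<in> space M. Y n \<omega> \<in> F}
        \<le> prob ({\<omega> \<in> space M. Y n \<omega> \<notin> K} \<union> (\<Union>c\<in>C. {\<omega> \<in> space M. Y n \<omega> \<in> A c}))"
      using C mA mK by (intro finite_measure_mono sets.Un sets.finite_UN) auto
    also have "\<dots> \<le> prob {\<omega> \<in> space M. Y n \<omega> \<notin> K} + prob (\<Union>c\<in>C. {\<omega> \<in> space M. Y n \<omega> \<in> A c})"
      using C mA mK by (intro measure_Un_le sets.finite_UN) auto
    also have "prob (\<Union>c\<in>C. {\<omega> \<in> space M. Y n \<omega> \<in> A c}) \<le> (\<Sum>c\<in>C. prob {\<omega> \<in> space M. Y n \<omega> \<in> A c})"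
      using C mA by (intro measure_UNION_le) auto
    also have "\<dots> \<le> (\<Sum>c\<in>C. exp (- (u * real n)))"
      using elim by (intro sum_mono) auto
    finally show ?case using elim by (simp add: algebra_simps)
  qed
qed

text \<open>A negative rate would force the probability of the whole space to grow
  exponentially.\<close>

lemma local_LDP_nonneg:
  assumes "local_LDP M Y I"
  shows "0 \<le> I x"
proof (rule ccontr)
  assume "\<not> 0 \<le> I x"
  then have "I x < 0" by simp
  then obtain r where r: "I x < ereal r" "ereal r < 0" using ereal_dense2[OF \<open>I x < 0\<close>] by blast
  have "\<forall>\<^sub>F n in sequentially. prob {\<omega> \<in> space M. Y n \<omega> \<in> UNIV} \<le> exp (- (0 * real n))" by simp
  from eventually_exp_bounds_False[OF _ local_LDP_lower[OF assms r(1) open_UNIV] this] r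
  show False by simp
qed

text \<open>A neighbourhood of x that satisfies the upper bound at level \<open>s\<close> is also a
  neighbourhood of each of its other points, so the lower bound there excludes rates below
  \<open>s\<close>.\<close>

lemma local_LDP_lsc:
  assumes "local_LDP M Y I"
  shows "closed {x. I x \<le> \<alpha>}"
proof -
  have "\<exists>A. open A \<and> x \<in> A \<and> A \<subseteq> - {x. I x \<le> \<alpha>}" if "\<alpha> < I x" for x
  proof -
    from ereal_dense2[OF that] obtain s where s: "\<alpha> < ereal s" "ereal s < I x" by blast
    obtain r where r: "\<alpha> < ereal r" "ereal r < ereal s" using ereal_dense2[OF s(1)] by blast
    obtain A where A: "open A" "x \<in> A"
        "\<forall>\<^sub>F n in sequentially. prob {\<omega> \<in> space M. Y n \<omega> \<in> A} \<le> exp (- (s * real n))"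
      using local_LDP_upper[OF assms s(2)] .
    have "\<alpha> < I z" if "z \<in> A" for z
    proof (rule ccontr)
      assume "\<not> \<alpha> < I z"
      then have "I z < ereal r" using r by auto
      from eventually_exp_bounds_False[OF _ local_LDP_lower[OF assms this A(1) that] A(3)] r
      show False by simp
    qed
    then have "A \<subseteq> - {x. I x \<le> \<alpha>}" by (fastforce dest: leD)
    then show ?thesis using A by blast
  qed
  then have "open (- {x. I x \<le> \<alpha>})"
    by (subst open_subopen) (auto simp: not_le)
  then show ?thesis by (simp add: closed_def)
qed

lemma local_LDP_compact_level:
  assumes "local_LDP M Y I"
  shows "compact {x. I x \<le> ereal \<alpha>}"
proof -
  obtain K where K: "compact K"
      \<comment> \<open>A level point has rate below \<open>\<alpha> + 1\<close>; the second unit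
        separates this strictly from the decay outside \<open>K\<close>.\<close>
      "\<forall>\<^sub>F n in sequentially. prob {\<omega> \<in> space M. Y n \<omega> \<notin> K} \<le> exp (- ((\<alpha> + 2) * real n))"
    using local_LDP_tight[OF assms] .
  have "{x. I x \<le> ereal \<alpha>} \<subseteq> K"
  proof
    fix x assume "x \<in> {x. I x \<le> ereal \<alpha>}"
    then have *: "I x < ereal (\<alpha> + 1)" by (auto intro: le_less_trans)
    show "x \<in> K"
    proof (rule ccontr)
      assume "x \<notin> K"
      with eventually_exp_bounds_False[OF _ local_LDP_lower[OF assms *, of "- K"], of "\<alpha> + 2"] K
      show False by (simp add: compact_imp_closed open_Compl)
    qed
  qed
  then have "{x. I x \<le> ereal \<alpha>} = {x. I x \<le> ereal \<alpha>} \<inter> K" by blast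
  then show ?thesis
    using K(1) local_LDP_lsc[OF assms] by (metis closed_Int_compact)
qed

lemma local_LDP_imp_good_rate_function:
  "local_LDP M Y I \<Longrightarrow> good_rate_function I"
  unfolding good_rate_function_def rate_function_def
  by (simp add: local_LDP_nonneg local_LDP_lsc local_LDP_compact_level)

lemma local_LDP_imp_satisfies_LDP:
  fixes Y :: "nat \<Rightarrow> 'a \<Rightarrow> 'b::metric_space"
  assumes Y: "local_LDP M Y I"
  shows "satisfies_LDP M Y I"
  unfolding satisfies_LDP_def
proof (intro conjI allI impI)
  show "rate_function I"
    using local_LDP_imp_good_rate_function[OF Y] by (simp add: good_rate_function_def)
  show "Y n \<in> borel_measurable M" if "n \<ge> 1" for n
    using local_LDP_measurable[OF Y that] .
next
  fix G :: "'b set" assume "open G"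
  show "- (INF x\<in>G. I x) \<le>
      liminf (\<lambda>n. ereal (1 / real n) * ext_ln (emeasure M {\<omega> \<in> space M. Y n \<omega> \<in> G}))"
    unfolding le_Liminf_iff
  proof (intro allI impI)
    fix y assume "y < - (INF x\<in>G. I x)"
    then have "(INF x\<in>G. I x) < - y" by (simp add: ereal_less_uminus_reorder)
    then obtain x where x: "x \<in> G" "I x < - y" by (auto simp: INF_less_iff)
    from ereal_dense2[OF x(2)] obtain r where r: "I x < ereal r" "ereal r < - y" by blast
    show "\<forall>\<^sub>F n in sequentially.
        y < ereal (1 / real n) * ext_ln (emeasure M {\<omega> \<in> space M. Y n \<omega> \<in> G})"
      using local_LDP_lower[OF Y r(1) \<open>open G\<close> x(1)] eventually_ge_at_top[of 1]
    proof eventually_elim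
      case (elim n)
      have "y < ereal (- r)" using r(2) by (cases y) auto
      also have "\<dots> \<le> ereal (1 / real n) * ext_ln (emeasure M {\<omega> \<in> space M. Y n \<omega> \<in> G})"
        using ext_ln_ge[OF elim(2,1)] by (simp add: emeasure_eq_measure)
      finally show ?case .
    qed
  qed
next
  fix F :: "'b set" assume "closed F"
  show "limsup (\<lambda>n. ereal (1 / real n) * ext_ln (emeasure M {\<omega> \<in> space M. Y n \<omega> \<in> F}))
      \<le> - (INF x\<in>F. I x)"
    unfolding Limsup_le_iff
  proof (intro allI impI)
    fix y assume "y > - (INF x\<in>F. I x)"
    then have y: "- y < (INF x\<in>F. I x)" by (simp add: ereal_uminus_less_reorder)
    from ereal_dense2[OF y] obtain s where s: "- y < ereal s" "ereal s < (INF x\<in>F. I x)" by blast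
    \<comment> \<open>Two intermediate reals are taken because \<open>local_LDP_closed_bound\<close>
      loses a little when it passes from \<open>s\<close> to \<open>r\<close>.\<close>
    from ereal_dense2[OF s(1)] obtain r where r: "- y < ereal r" "ereal r < ereal s" by blast
    have "ereal s \<le> I x" if "x \<in> F" for x
      using s(2) that by (meson INF_lower less_imp_le order_trans)
    from local_LDP_closed_bound[OF Y \<open>closed F\<close> _ this, of r] r(2)
    have "\<forall>\<^sub>F n in sequentially. prob {\<omega> \<in> space M. Y n \<omega> \<in> F} \<le> exp (- (r * real n))"
      by simp
    then show "\<forall>\<^sub>F n in sequentially.
        ereal (1 / real n) * ext_ln (emeasure M {\<omega> \<in> space M. Y n \<omega> \<in> F}) < y"
      using eventually_ge_at_top[of 1]
    proof eventually_elim
      case (elim n)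
      have "ereal (1 / real n) * ext_ln (emeasure M {\<omega> \<in> space M. Y n \<omega> \<in> F}) \<le> ereal (- r)"
        using ext_ln_le[OF elim(2,1)] by (simp add: emeasure_eq_measure)
      also have "\<dots> < y" using r(1) by (cases y) auto
      finally show ?case .
    qed
  qed
qed

text \<open>The delicate part is the local upper bound, since the preimage of a small ball need not
  be small. The level set of \<open>I\<close> at height \<open>s\<close> is compact, so its image is
  closed and misses \<open>y\<close>; hence \<open>I\<close> exceeds \<open>s\<close> on the whole
  preimage of some ball around \<open>y\<close>, and the bound for closed sets applies
  there.\<close>

lemma local_LDP_contraction:
  fixes Y :: "nat \<Rightarrow> 'a \<Rightarrow> 'b::metric_space" and f :: "'b \<Rightarrow> 'c::metric_space"
  assumes Y: "local_LDP M Y I" and f: "continuous_on UNIV f"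
  shows "local_LDP M (\<lambda>n \<omega>. f (Y n \<omega>)) (\<lambda>y. INF x\<in>{x. f x = y}. I x)"
    (is "local_LDP M _ ?J")
  unfolding local_LDP_def
proof (intro conjI allI impI)
  fix n :: nat assume "1 \<le> n"
  then show "(\<lambda>\<omega>. f (Y n \<omega>)) \<in> borel_measurable M"
    by (intro borel_measurable_continuous_on[OF f] local_LDP_measurable[OF Y])
next
  fix y r assume r: "ereal r < ?J y"
  from ereal_dense2[OF r] obtain s where s: "ereal r < ereal s" "ereal s < ?J y" by blast
  define C where "C = f ` {x. I x \<le> ereal s}"
  have "compact C" unfolding C_def
    by (intro compact_continuous_image local_LDP_compact_level[OF Y] continuous_on_subset[OF f]) simp
  moreover have "y \<notin> C"
  proof
    assume "y \<in> C"
    then obtain x where "f x = y" "I x \<le> ereal s" by (auto simp: C_def)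
    then have "?J y \<le> ereal s" by (intro INF_lower2[of x]) auto
    with s show False by simp
  qed
  ultimately have "open (- C)" "y \<in> - C" by (auto simp: compact_imp_closed open_Compl)
  \<comment> \<open>The ball is closed so that its preimage is closed; its interior serves as the
    neighbourhood of \<open>y\<close>.\<close>
  then obtain e where e: "e > 0" "cball y e \<subseteq> - C" by (meson open_contains_cball)
  have "closed (f -` cball y e)" by (intro closed_vimage closed_cball f)
  moreover have "ereal s \<le> I x" if "x \<in> f -` cball y e" for x
    using that e(2) by (fastforce simp: C_def)
  ultimately have "\<forall>\<^sub>F n in sequentially. prob {\<omega> \<in> space M. Y n \<omega> \<in> f -` cball y e} \<le> exp (- (r * real n))"
    using s(1) by (intro local_LDP_closed_bound[OF Y, of _ r s]) auto
  then have "\<forall>\<^sub>F n in sequentially. prob {\<omega> \<in> space M. f (Y n \<omega>) \<in> ball y e} \<le> exp (- (r * real n))"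
    using eventually_ge_at_top[of 1]
  proof eventually_elim
    case (elim n)
    have "prob {\<omega> \<in> space M. f (Y n \<omega>) \<in> ball y e} \<le> prob {\<omega> \<in> space M. Y n \<omega> \<in> f -` cball y e}"
    proof (rule finite_measure_mono)
      have "Y n -` (f -` cball y e) \<inter> space M \<in> events"
        by (intro measurable_sets[OF local_LDP_measurable[OF Y elim(2)]] borel_closed
            \<open>closed (f -` cball y e)\<close>)
      also have "Y n -` (f -` cball y e) \<inter> space M = {\<omega> \<in> space M. Y n \<omega> \<in> f -` cball y e}" by auto
      finally show "{\<omega> \<in> space M. Y n \<omega> \<in> f -` cball y e} \<in> events" .
    qed auto
    then show ?case using elim by linarith
  qed
  then show "\<exists>A. open A \<and> y \<in> A \<and>
      (\<forall>\<^sub>F n in sequentially. prob {\<omega> \<in> space M. f (Y n \<omega>) \<in> A} \<le> exp (- (r * real n)))"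
    using e(1) by (intro exI[of _ "ball y e"]) auto
next
  fix y r and A :: "'c set" assume "?J y < ereal r" "open A" "y \<in> A"
  then obtain x where x: "f x = y" "I x < ereal r" by (auto simp: INF_less_iff)
  have "open (f -` A)" using f \<open>open A\<close> by (simp add: open_vimage)
  from local_LDP_lower[OF Y x(2) this] x \<open>y \<in> A\<close>
  show "\<forall>\<^sub>F n in sequentially. exp (- (r * real n)) \<le> prob {\<omega> \<in> space M. f (Y n \<omega>) \<in> A}" by simp
next
  fix r
  obtain K where K: "compact K"
      "\<forall>\<^sub>F n in sequentially. prob {\<omega> \<in> space M. Y n \<omega> \<notin> K} \<le> exp (- (r * real n))"
    using local_LDP_tight[OF Y] .
  have "compact (f ` K)" using K(1) f by (meson compact_continuous_image continuous_on_subset subset_UNIV)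
  moreover have "\<forall>\<^sub>F n in sequentially. prob {\<omega> \<in> space M. f (Y n \<omega>) \<notin> f ` K} \<le> exp (- (r * real n))"
    using K(2) eventually_ge_at_top[of 1]
  proof eventually_elim
    case (elim n)
    have [measurable]: "Y n \<in> borel_measurable M" using local_LDP_measurable[OF Y elim(2)] .
    have [measurable]: "K \<in> sets borel" using K by (simp add: borel_compact)
    have "prob {\<omega> \<in> space M. f (Y n \<omega>) \<notin> f ` K} \<le> prob {\<omega> \<in> space M. Y n \<omega> \<notin> K}"
      by (intro finite_measure_mono) auto
    then show ?case using elim by linarith
  qed
  ultimately show "\<exists>K. compact K \<and>
      (\<forall>\<^sub>F n in sequentially. prob {\<omega> \<in> space M. f (Y n \<omega>) \<notin> K} \<le> exp (- (r * real n)))" by blast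
qed

end

text \<open>Two finite summands give up half of the slack each; an infinite summand makes up for any
  deficit of the other. The value \<open>-\<infinity>\<close> must be excluded because
  \<open>\<infinity> + (-\<infinity>) = \<infinity>\<close>, while no real lies below
  \<open>-\<infinity>\<close>.\<close>

lemma ereal_less_add_split:
  fixes x y :: ereal
  assumes "ereal r < x + y" "x \<noteq> -\<infinity>" "y \<noteq> -\<infinity>"
  shows "\<exists>u v. ereal u < x \<and> ereal v < y \<and> r < u + v"
proof -
  obtain s where s: "ereal r < ereal s" "ereal s < x + y" using ereal_dense2[OF assms(1)] by blast
  show ?thesis
  proof (cases x)
    case (real a)
    show ?thesis
    proof (cases y)
      case (real b)
      have "ereal (a - (a + b - s) / 2) < x \<and> ereal (b - (a + b - s) / 2) < y
          \<and> r < (a - (a + b - s) / 2) + (b - (a + b - s) / 2)"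
        using s real \<open>x = ereal a\<close> by (simp add: field_simps)
      then show ?thesis by blast
    next
      case PInf
      have "ereal (a - 1) < x \<and> ereal (s - a + 1) < y \<and> r < (a - 1) + (s - a + 1)"
        using s PInf \<open>x = ereal a\<close> by simp
      then show ?thesis by blast
    qed (use assms in simp)
  next
    case PInf
    have "-\<infinity> < y" using assms(3) by simp
    from ereal_dense2[OF this] obtain v where v: "ereal v < y" by blast
    have "ereal (s - v) < x \<and> ereal v < y \<and> r < (s - v) + v"
      using s PInf v by simp
    then show ?thesis by blast
  qed (use assms in simp)
qed

lemma ereal_add_less_split:
  fixes x y :: ereal
  assumes "x + y < ereal r" "x \<noteq> -\<infinity>" "y \<noteq> -\<infinity>"
  shows "\<exists>u v. x < ereal u \<and> y < ereal v \<and> u + v = r"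
proof -
  have "x \<noteq> \<infinity>" "y \<noteq> \<infinity>" using assms by auto
  then obtain a b where ab: "x = ereal a" "y = ereal b" using assms by (cases x; cases y) auto
  have "x < ereal (a + (r - (a + b)) / 2) \<and> y < ereal (b + (r - (a + b)) / 2)
      \<and> (a + (r - (a + b)) / 2) + (b + (r - (a + b)) / 2) = r"
    using assms ab by (simp add: field_simps)
  then show ?thesis by blast
qed

section \<open>Independent pairs\<close>

context prob_space
begin

text \<open>Open rectangles form a base of the product topology and, by independence, their
  probabilities multiply, so exponential rates add.\<close>

lemma local_LDP_Pair:
  fixes X Y :: "nat \<Rightarrow> 'a \<Rightarrow> 'b::{second_countable_topology, t2_space}"
  assumes X: "local_LDP M X I" and Y: "local_LDP M Y J"
    and indep: "\<And>n. 1 \<le> n \<Longrightarrow> indep_var borel (X n) borel (Y n)"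
  shows "local_LDP M (\<lambda>n \<omega>. (X n \<omega>, Y n \<omega>)) (\<lambda>(x, y). I x + J y)"
proof -
  have prob_times: "prob {\<omega> \<in> space M. (X n \<omega>, Y n \<omega>) \<in> A \<times> B}
      = prob {\<omega> \<in> space M. X n \<omega> \<in> A} * prob {\<omega> \<in> space M. Y n \<omega> \<in> B}"
    if "1 \<le> n" "open A" "open B" for n A B
  proof -
    have "prob ((\<lambda>\<omega>. (X n \<omega>, Y n \<omega>)) -` (A \<times> B) \<inter> space M)
        = prob (X n -` A \<inter> space M) * prob (Y n -` B \<inter> space M)"
      by (rule indep_varD[OF indep[OF that(1)]]) (use that in simp_all)
    then show ?thesis
      by (simp only: vimage_def Int_def mem_Collect_eq conj_commute)
  qed
  show ?thesis
    unfolding local_LDP_def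
  proof (intro conjI allI impI)
    fix n :: nat assume "1 \<le> n"
    then show "(\<lambda>\<omega>. (X n \<omega>, Y n \<omega>)) \<in> borel_measurable M"
      using local_LDP_measurable[OF X] local_LDP_measurable[OF Y] by (intro borel_measurable_Pair) auto
  next
    fix z :: "'b \<times> 'b" and r
    obtain x y where z: "z = (x, y)" by (cases z)
    assume "ereal r < (case z of (x, y) \<Rightarrow> I x + J y)"
    then have r: "ereal r < I x + J y" by (simp add: z)
    have "I x \<noteq> -\<infinity>" "J y \<noteq> -\<infinity>"
      using local_LDP_nonneg[OF X, of x] local_LDP_nonneg[OF Y, of y] by auto
    from ereal_less_add_split[OF r this]
    obtain u v where uv: "ereal u < I x" "ereal v < J y" "r < u + v" by blast
    obtain A where A: "open A" "x \<in> A"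
        "\<forall>\<^sub>F n in sequentially. prob {\<omega> \<in> space M. X n \<omega> \<in> A} \<le> exp (- (u * real n))"
      using local_LDP_upper[OF X uv(1)] .
    obtain B where B: "open B" "y \<in> B"
        "\<forall>\<^sub>F n in sequentially. prob {\<omega> \<in> space M. Y n \<omega> \<in> B} \<le> exp (- (v * real n))"
      using local_LDP_upper[OF Y uv(2)] .
    have "\<forall>\<^sub>F n in sequentially. prob {\<omega> \<in> space M. (X n \<omega>, Y n \<omega>) \<in> A \<times> B} \<le> exp (- (r * real n))"
      using A(3) B(3) eventually_ge_at_top[of 1]
    proof eventually_elim
      case (elim n)
      have "prob {\<omega> \<in> space M. (X n \<omega>, Y n \<omega>) \<in> A \<times> B} \<le> exp (- (u * real n)) * exp (- (v * real n))"
        unfolding prob_times[OF elim(3) A(1) B(1)] using elim by (intro mult_mono) auto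
      also have "\<dots> = exp (- ((u + v) * real n))" by (simp add: mult_exp_exp algebra_simps)
      also have "\<dots> \<le> exp (- (r * real n))" using uv(3) by (simp add: mult_right_mono)
      finally show ?case .
    qed
    then show "\<exists>A. open A \<and> z \<in> A \<and>
        (\<forall>\<^sub>F n in sequentially. prob {\<omega> \<in> space M. (X n \<omega>, Y n \<omega>) \<in> A} \<le> exp (- (r * real n)))"
      using A B z by (intro exI[of _ "A \<times> B"]) (auto intro: open_Times)
  next
    fix z :: "'b \<times> 'b" and r and C :: "('b \<times> 'b) set"
    obtain x y where z: "z = (x, y)" by (cases z)
    assume "(case z of (x, y) \<Rightarrow> I x + J y) < ereal r" and C: "open C" "z \<in> C"
    then have r: "I x + J y < ereal r" by (simp add: z)
    have "I x \<noteq> -\<infinity>" "J y \<noteq> -\<infinity>"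
      using local_LDP_nonneg[OF X, of x] local_LDP_nonneg[OF Y, of y] by auto
    from ereal_add_less_split[OF r this]
    obtain u v where uv: "I x < ereal u" "J y < ereal v" "u + v = r" by blast
    obtain A B where AB: "open A" "open B" "z \<in> A \<times> B" "A \<times> B \<subseteq> C"
      using open_prod_elim[OF C] .
    have "x \<in> A" "y \<in> B" using AB(3) z by auto
    then have "\<forall>\<^sub>F n in sequentially. exp (- (u * real n)) \<le> prob {\<omega> \<in> space M. X n \<omega> \<in> A}"
         "\<forall>\<^sub>F n in sequentially. exp (- (v * real n)) \<le> prob {\<omega> \<in> space M. Y n \<omega> \<in> B}"
      using local_LDP_lower[OF X uv(1) AB(1)] local_LDP_lower[OF Y uv(2) AB(2)] by blast+
    then show "\<forall>\<^sub>F n in sequentially. exp (- (r * real n)) \<le> prob {\<omega> \<in> space M. (X n \<omega>, Y n \<omega>) \<in> C}"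
      using eventually_ge_at_top[of 1]
    proof eventually_elim
      case (elim n)
      have [measurable]: "X n \<in> borel_measurable M" "Y n \<in> borel_measurable M"
        using local_LDP_measurable[OF X] local_LDP_measurable[OF Y] elim by auto
      \<comment> \<open>Second countability identifies the product of the Borel sigma-algebras with
        the Borel sigma-algebra of the product, so an arbitrary open \<open>C\<close> gives an
        event.\<close>
      have [measurable]: "C \<in> sets (borel \<Otimes>\<^sub>M borel)" unfolding borel_prod using C by (intro borel_open)
      have "r * real n = u * real n + v * real n"
        by (simp flip: uv(3) distrib_right)
      then have "exp (- (r * real n)) = exp (- (u * real n)) * exp (- (v * real n))"
        by (simp add: mult_exp_exp)
      also have "\<dots> \<le> prob {\<omega> \<in> space M. (X n \<omega>, Y n \<omega>) \<in> A \<times> B}"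
        unfolding prob_times[OF elim(3) AB(1,2)] using elim by (intro mult_mono) auto
      also have "\<dots> \<le> prob {\<omega> \<in> space M. (X n \<omega>, Y n \<omega>) \<in> C}"
        using AB by (intro finite_measure_mono) auto
      finally show ?case .
    qed
  next
    fix r
    obtain K where K: "compact K"
        "\<forall>\<^sub>F n in sequentially. prob {\<omega> \<in> space M. X n \<omega> \<notin> K} \<le> exp (- ((r + 1) * real n))"
      using local_LDP_tight[OF X] .
    obtain L where L: "compact L"
        "\<forall>\<^sub>F n in sequentially. prob {\<omega> \<in> space M. Y n \<omega> \<notin> L} \<le> exp (- ((r + 1) * real n))"
      using local_LDP_tight[OF Y] .
    \<comment> \<open>One extra unit of rate in both tightness bounds absorbs the factor 2 of the
      union bound.\<close>
    have two: "\<forall>\<^sub>F n in sequentially. 2 * exp (- ((r + 1) * real n)) \<le> exp (- (r * real n))"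
      by (intro eventually_mult_exp_le) simp
    have "\<forall>\<^sub>F n in sequentially. prob {\<omega> \<in> space M. (X n \<omega>, Y n \<omega>) \<notin> K \<times> L} \<le> exp (- (r * real n))"
      using K(2) L(2) eventually_ge_at_top[of 1] two
    proof eventually_elim
      case (elim n)
      have [measurable]: "X n \<in> borel_measurable M" "Y n \<in> borel_measurable M"
        using local_LDP_measurable[OF X] local_LDP_measurable[OF Y] elim by auto
      have [measurable]: "K \<in> sets borel" "L \<in> sets borel" using K L by (auto simp: borel_compact)
      have "prob {\<omega> \<in> space M. (X n \<omega>, Y n \<omega>) \<notin> K \<times> L}
          \<le> prob ({\<omega> \<in> space M. X n \<omega> \<notin> K} \<union> {\<omega> \<in> space M. Y n \<omega> \<notin> L})"
        by (intro finite_measure_mono) auto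
      also have "\<dots> \<le> prob {\<omega> \<in> space M. X n \<omega> \<notin> K} + prob {\<omega> \<in> space M. Y n \<omega> \<notin> L}"
        by (intro measure_Un_le) auto
      finally show ?case using elim by linarith
    qed
    then show "\<exists>K. compact K \<and>
        (\<forall>\<^sub>F n in sequentially. prob {\<omega> \<in> space M. (X n \<omega>, Y n \<omega>) \<notin> K} \<le> exp (- (r * real n)))"
      using K L by (intro exI[of _ "K \<times> L"]) (auto intro: compact_Times)
  qed
qed

end

section \<open>Order statistics of uniform variables\<close>

lemma sorted_filter_eq_takeWhile:
  assumes "sorted xs" "\<And>x y. Q y \<Longrightarrow> x \<le> y \<Longrightarrow> Q x"
  shows "filter Q xs = takeWhile Q xs"
  using assms(1)
proof (induction xs)
  case (Cons a xs)
  show ?case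
  proof (cases "Q a")
    case False
    then have "\<forall>x\<in>set xs. \<not> Q x" using Cons.prems assms(2) by auto
    then have "filter Q xs = []" by (simp add: filter_empty_conv)
    then show ?thesis using False by simp
  qed (use Cons in simp)
qed simp

text \<open>The entries satisfying a downward closed \<open>Q\<close> form an initial segment of the
  sorted list, whose length does not depend on the ordering. Taking \<open>Q\<close> to be
  \<open>x \<le> a\<close> or \<open>x < b\<close> turns statements about order statistics into
  counts.\<close>

lemma order_stat_iff_card:
  assumes "1 \<le> k" "k \<le> n" and Q: "\<And>x y. Q y \<Longrightarrow> x \<le> y \<Longrightarrow> Q x"
  shows "Q (order_stat u n k) \<longleftrightarrow> k \<le> card {i \<in> {1..n}. Q (u i)}"
proof -
  define ys where "ys = sort (map u [1..<Suc n])"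
  have ys: "sorted ys" "length ys = n" by (auto simp: ys_def)
  have "length (filter Q ys) = length (filter Q (map u [1..<Suc n]))"
    by (rule mset_eq_length) (simp add: ys_def)
  also have "\<dots> = length (filter (\<lambda>i. Q (u i)) [1..<Suc n])"
    by (simp only: filter_map length_map comp_def)
  also have "\<dots> = card (set (filter (\<lambda>i. Q (u i)) [1..<Suc n]))"
    by (rule distinct_card[symmetric]) simp
  also have "set (filter (\<lambda>i. Q (u i)) [1..<Suc n]) = {i \<in> {1..n}. Q (u i)}" by auto
  finally have len: "length (takeWhile Q ys) = card {i \<in> {1..n}. Q (u i)}"
    using sorted_filter_eq_takeWhile[of ys Q] ys Q by metis
  have "Q (ys ! (k - 1)) \<longleftrightarrow> k - 1 < length (takeWhile Q ys)"
  proof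
    assume "k - 1 < length (takeWhile Q ys)"
    then show "Q (ys ! (k - 1))"
      by (metis nth_mem set_takeWhileD takeWhile_nth)
  next
    assume *: "Q (ys ! (k - 1))"
    show "k - 1 < length (takeWhile Q ys)"
    proof (rule ccontr)
      assume "\<not> k - 1 < length (takeWhile Q ys)"
      then have le: "length (takeWhile Q ys) \<le> k - 1" by simp
      then have "length (takeWhile Q ys) < length ys" using ys assms by simp
      from nth_length_takeWhile[OF this] sorted_nth_mono[OF ys(1) le] * Q ys assms
      show False by auto
    qed
  qed
  then show ?thesis using assms len by (auto simp: order_stat_def ys_def)
qed

lemma order_stat_in_image:
  assumes "1 \<le> k" "k \<le> n"
  shows "order_stat u n k \<in> u ` {1..n}"
proof -
  have "sort (map u [1..<Suc n]) ! (k - 1) \<in> set (sort (map u [1..<Suc n]))"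
    using assms by (intro nth_mem) auto
  also have "\<dots> = u ` {1..n}" by (simp only: set_sort set_map set_upt atLeastLessThanSuc_atLeastAtMost)
  finally show ?thesis using assms by (simp add: order_stat_def)
qed

text \<open>A crude Stirling formula: an error of order \<open>ln m\<close> disappears after
  division by \<open>n\<close>. The induction rests on \<open>m * (ln (m + 1) - ln m) \<le> 1 \<le>
  (m + 1) * (ln (m + 1) - ln m)\<close>. The case \<open>m = 0\<close> is consistent because
  \<open>ln 0 = 0\<close>.\<close>

lemma ln_fact_bounds:
  "real m * ln m - m \<le> ln (fact m) \<and> ln (fact m) \<le> real m * ln m - m + ln m + (1::real)"
proof (induction m)
  case 0
  then show ?case by simp
next
  case (Suc m)
  show ?case
  proof (cases "m = 0")
    case True
    then show ?thesis by simp
  next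
    case False
    define a where "a = ln (real m)"
    define b where "b = ln (real (Suc m))"
    have "b - a \<le> (real (Suc m) - real m) / real m"
      unfolding a_def b_def using False by (intro ln_diff_le) auto
    then have 1: "real m * (b - a) \<le> 1" using False by (simp add: field_simps)
    have "a - b \<le> (real m - real (Suc m)) / real (Suc m)"
      unfolding a_def b_def using False by (intro ln_diff_le) auto
    then have 2: "1 \<le> real (Suc m) * (b - a)" by (simp add: field_simps)
    have "ln (fact (Suc m) :: real) = b + ln (fact m)"
      by (simp add: b_def ln_mult)
    then show ?thesis using Suc 1 2 unfolding a_def[symmetric] b_def[symmetric]
      by (simp add: algebra_simps)
  qed
qed

lemma tendsto_floor_ratio:
  assumes "0 \<le> t"
  shows "(\<lambda>n. real (nat \<lfloor>real n * t\<rfloor>) / real n) \<longlonglongrightarrow> t"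
proof (rule tendsto_sandwich)
  show "\<forall>\<^sub>F n in sequentially. t - 1 / real n \<le> real (nat \<lfloor>real n * t\<rfloor>) / real n"
    using eventually_gt_at_top[of 0]
  proof eventually_elim
    case (elim n)
    have "real n * t - 1 \<le> real (nat \<lfloor>real n * t\<rfloor>)" using assms by linarith
    then have "(real n * t - 1) / real n \<le> real (nat \<lfloor>real n * t\<rfloor>) / real n"
      by (rule divide_right_mono) simp
    then show ?case using elim by (simp add: diff_divide_distrib)
  qed
  show "\<forall>\<^sub>F n in sequentially. real (nat \<lfloor>real n * t\<rfloor>) / real n \<le> t"
    using eventually_gt_at_top[of 0]
  proof eventually_elim
    case (elim n)
    have "real (nat \<lfloor>real n * t\<rfloor>) \<le> real n * t" using assms by simp
    then show ?case using elim by (simp add: field_simps)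
  qed
  show "(\<lambda>n. t - 1 / real n) \<longlonglongrightarrow> t"
    using tendsto_diff[OF tendsto_const lim_1_over_n, of t] by simp
qed simp

lemma nat_floor_mult_le:
  assumes "t \<le> 1"
  shows "nat \<lfloor>real n * t\<rfloor> \<le> n"
proof -
  have "real n * t \<le> real n" using assms by (simp add: mult_left_le)
  then show ?thesis by linarith
qed

text \<open>With \<open>e\<close> the Stirling error, \<open>ln (n choose k n) / n\<close> is
  exactly the entropy of \<open>p n = k n / n\<close> plus
  \<open>(e n - e (k n) - e (n - k n)) / n\<close>, and the numerator is at most
  \<open>2 * (ln n + 1)\<close> in absolute value.\<close>

lemma tendsto_ln_binomial:
  fixes k :: "nat \<Rightarrow> nat"
  assumes t: "0 < t" "t \<le> 1" and k: "\<And>n. k n = nat \<lfloor>real n * t\<rfloor>"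
  shows "(\<lambda>n. ln (real (n choose k n)) / real n) \<longlonglongrightarrow> - (t * ln t + (1 - t) * ln (1 - t))"
proof -
  define p where "p n = real (k n) / real n" for n
  define e where "e m = ln (fact m) - real m * ln (real m) + real m" for m
  have p: "p \<longlonglongrightarrow> t" unfolding p_def k using t by (intro tendsto_floor_ratio) simp
  have kn: "k n \<le> n" for n unfolding k using t(2) by (rule nat_floor_mult_le)
  have e: "0 \<le> e m" "e m \<le> ln (real m) + 1" for m
    using ln_fact_bounds[of m] by (auto simp: e_def)
  \<comment> \<open>For \<open>t = 1\<close> the argument \<open>1 - p n\<close> tends to 0, where
    \<open>ln\<close> is not continuous; there \<open>k n = n\<close>, and the term vanishes
    identically.\<close>
  have q: "(\<lambda>n. (1 - p n) * ln (1 - p n)) \<longlonglongrightarrow> (1 - t) * ln (1 - t)"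
  proof (cases "t = 1")
    case True
    then have "(1 - p n) * ln (1 - p n) = 0" for n by (cases "n = 0") (auto simp: p_def k)
    then have "(\<lambda>n. (1 - p n) * ln (1 - p n)) = (\<lambda>n. 0)" by blast
    then show ?thesis using True by simp
  next
    case False
    then show ?thesis using t p by (intro tendsto_intros) auto
  qed
  have h: "(\<lambda>n. - (p n * ln (p n) + (1 - p n) * ln (1 - p n))) \<longlonglongrightarrow> - (t * ln t + (1 - t) * ln (1 - t))"
    using t by (intro tendsto_minus tendsto_add[OF _ q] tendsto_mult tendsto_ln p) simp
  have "(\<lambda>n. 2 * (ln (real n) / real n + 1 / real n)) \<longlonglongrightarrow> 2 * (0 + 0)"
    by (intro tendsto_intros lim_ln_over_n lim_1_over_n)
  then have "(\<lambda>n. 2 * (ln (real n) / real n + 1 / real n)) \<longlonglongrightarrow> 0" by simp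
  then have err: "(\<lambda>n. (e n - e (k n) - e (n - k n)) / real n) \<longlonglongrightarrow> 0"
  proof (rule Lim_null_comparison[rotated])
    show "\<forall>\<^sub>F n in sequentially. norm ((e n - e (k n) - e (n - k n)) / real n)
        \<le> 2 * (ln (real n) / real n + 1 / real n)"
      using eventually_gt_at_top[of 0]
    proof eventually_elim
      case (elim n)
      have mono: "ln (real m) \<le> ln (real n)" if "m \<le> n" for m
        using that elim by (cases "m = 0") auto
      have "\<bar>e n - e (k n) - e (n - k n)\<bar> \<le> 2 * (ln (real n) + 1)"
        using e[of n] e[of "k n"] e[of "n - k n"] mono[OF kn] mono[of "n - k n"] mono[of 1] elim
        by (simp add: abs_le_iff)
      then show ?case using elim by (simp add: field_simps)
    qed
  qed
  show ?thesis
  proof (rule Lim_transform_eventually[OF tendsto_add[OF h err, simplified add_0_right]])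
    show "\<forall>\<^sub>F n in sequentially. - (p n * ln (p n) + (1 - p n) * ln (1 - p n)) +
        (e n - e (k n) - e (n - k n)) / real n = ln (real (n choose k n)) / real n"
      using eventually_gt_at_top[of 0]
    proof eventually_elim
      case (elim n)
      have "ln (real (n choose k n)) = ln (fact n) - ln (fact (k n)) - ln (fact (n - k n))"
        by (simp add: binomial_fact[OF kn] ln_div ln_mult)
      moreover have "real (k n) * ln (real (k n)) = real (k n) * (ln (p n) + ln (real n))"
        using elim by (cases "k n = 0") (auto simp: p_def ln_div)
      moreover have "real (n - k n) * ln (real (n - k n)) = real (n - k n) * (ln (1 - p n) + ln (real n))"
      proof (cases "k n = n")
        case False
        then have "k n < n" using kn[of n] by simp
        then have "1 - p n = real (n - k n) / real n"
          using elim by (simp add: p_def field_simps of_nat_diff)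
        then show ?thesis using elim \<open>k n < n\<close> by (simp add: ln_div)
      qed simp
      moreover have kp: "real (k n) = p n * real n" "real (n - k n) = (1 - p n) * real n"
        using elim kn[of n] by (auto simp: p_def of_nat_diff field_simps)
      ultimately have "ln (real (n choose k n)) = e n - e (k n) - e (n - k n)
          - real (k n) * ln (p n) - real (n - k n) * ln (1 - p n)"
        using kn[of n] by (simp add: e_def of_nat_diff algebra_simps)
      then show ?case
        unfolding kp using elim by (simp add: field_simps)
    qed
  qed
qed

lemma eventually_le_exp:
  fixes f :: "nat \<Rightarrow> real"
  assumes "(\<lambda>n. ln (f n) / real n) \<longlonglongrightarrow> L" "L < - r" "\<forall>\<^sub>F n in sequentially. 0 < f n"
  shows "\<forall>\<^sub>F n in sequentially. f n \<le> exp (- (r * real n))"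
  using order_tendstoD(2)[OF assms(1,2)] assms(3) eventually_gt_at_top[of 0]
proof eventually_elim
  case (elim n)
  then have "ln (f n) \<le> - (r * real n)" by (simp add: field_simps)
  then show ?case using elim(2) by (metis exp_le_cancel_iff exp_ln)
qed

lemma eventually_ge_exp:
  fixes f :: "nat \<Rightarrow> real"
  assumes "(\<lambda>n. ln (f n) / real n) \<longlonglongrightarrow> L" "- r < L" "\<forall>\<^sub>F n in sequentially. 0 < f n"
  shows "\<forall>\<^sub>F n in sequentially. exp (- (r * real n)) \<le> f n"
  using order_tendstoD(1)[OF assms(1,2)] assms(3) eventually_gt_at_top[of 0]
proof eventually_elim
  case (elim n)
  then have "- (r * real n) \<le> ln (f n)" by (simp add: field_simps)
  then show ?case using elim(2) by (metis exp_le_cancel_iff exp_ln)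
qed

text \<open>Serves both bounds for the order statistic. The factor \<open>d\<close>, having a
  positive limit, is invisible on the exponential scale: it is 1 for the upper bound and collects
  the correction factors of the lower one.\<close>

lemma tendsto_ln_binomial_weight:
  fixes k :: "nat \<Rightarrow> nat"
  assumes t: "0 < t" "t \<le> 1" and k: "\<And>n. k n = nat \<lfloor>real n * t\<rfloor>" and ac: "0 < a" "0 < c"
    and d: "d \<longlonglongrightarrow> D" "0 < D"
  shows "(\<lambda>n. ln (real (n choose k n) * a ^ k n * c ^ (n - k n) * d n) / real n)
    \<longlonglongrightarrow> (t * ln a - t * ln t) + ((1 - t) * ln c - (1 - t) * ln (1 - t))"
proof -
  define p where "p n = real (k n) / real n" for n
  have p: "p \<longlonglongrightarrow> t" unfolding p_def k using t by (intro tendsto_floor_ratio) simp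
  have kn: "k n \<le> n" for n unfolding k using t(2) by (rule nat_floor_mult_le)
  have 1: "(\<lambda>n. ln (d n) * (1 / real n)) \<longlonglongrightarrow> ln D * 0"
    using d by (intro tendsto_mult tendsto_ln lim_1_over_n) auto
  have 2: "(\<lambda>n. p n * ln a + (1 - p n) * ln c) \<longlonglongrightarrow> t * ln a + (1 - t) * ln c"
    using p by (intro tendsto_intros)
  note tendsto_add[OF tendsto_add[OF tendsto_ln_binomial[OF t k] 2] 1]
  then have lim: "(\<lambda>n. ln (real (n choose k n)) / real n + (p n * ln a + (1 - p n) * ln c)
      + ln (d n) * (1 / real n))
      \<longlonglongrightarrow> (t * ln a - t * ln t) + ((1 - t) * ln c - (1 - t) * ln (1 - t))"
    by (simp add: algebra_simps)
  show ?thesis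
  proof (rule Lim_transform_eventually[OF lim])
    show "\<forall>\<^sub>F n in sequentially. ln (real (n choose k n)) / real n + (p n * ln a + (1 - p n) * ln c)
        + ln (d n) * (1 / real n) = ln (real (n choose k n) * a ^ k n * c ^ (n - k n) * d n) / real n"
      using eventually_gt_at_top[of 0] order_tendstoD(1)[OF d]
    proof eventually_elim
      case (elim n)
      have "0 < real (n choose k n)" using kn by (simp add: zero_less_binomial)
      then have "ln (real (n choose k n) * a ^ k n * c ^ (n - k n) * d n)
          = ln (real (n choose k n)) + real (k n) * ln a + real (n - k n) * ln c + ln (d n)"
        using ac elim by (simp add: ln_mult ln_realpow)
      then show ?case using elim(1) kn[of n] by (simp add: p_def of_nat_diff field_simps)
    qed
  qed
qed

section \<open>Bounds for one order statistic at fixed n\<close>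

context prob_space
begin

lemma prob_uniform:
  assumes [measurable]: "X \<in> borel_measurable M"
    and "distr M borel X = uniform_measure lborel {0..1::real}" and [measurable]: "A \<in> sets borel"
  shows "prob (X -` A \<inter> space M) = measure lborel ({0..1} \<inter> A)"
proof -
  have "prob (X -` A \<inter> space M) = measure (distr M borel X) A"
    by (simp add: measure_distr)
  also have "\<dots> = measure lborel ({0..1} \<inter> A)"
    by (simp add: assms(2))
  finally show ?thesis .
qed

text \<open>Sublevel sets of an order statistic are counting events, and the count is a finite sum
  of measurable indicators.\<close>

lemma measurable_order_stat:
  assumes X: "\<And>i. i \<in> {1..n} \<Longrightarrow> X i \<in> borel_measurable M" and "k \<le> n"
  shows "(\<lambda>\<omega>. order_stat (\<lambda>i. X i \<omega>) n k) \<in> borel_measurable M"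
proof (cases "k = 0")
  case True
  then show ?thesis by (simp add: order_stat_def)
next
  case False
  have eq: "(order_stat (\<lambda>i. X i \<omega>) n k \<le> z) \<longleftrightarrow> real k \<le> (\<Sum>i\<in>{1..n}. indicator {..z} (X i \<omega>))" for z \<omega>
  proof -
    have "(\<Sum>i\<in>{1..n}. indicator {..z} (X i \<omega>)) = (\<Sum>i\<in>{i \<in> {1..n}. X i \<omega> \<le> z}. 1::real)"
      by (intro sum.mono_neutral_cong_right) (auto simp: indicator_def)
    then have "(\<Sum>i\<in>{1..n}. indicator {..z} (X i \<omega>)) = real (card {i \<in> {1..n}. X i \<omega> \<le> z})" by simp
    then show ?thesis
      using order_stat_iff_card[of k n "\<lambda>x. x \<le> z" "\<lambda>i. X i \<omega>"] False assms(2) by auto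
  qed
  show ?thesis
    unfolding borel_measurable_iff_le
  proof
    fix z
    have "(\<lambda>\<omega>. \<Sum>i\<in>{1..n}. indicator {..z} (X i \<omega>) :: real) \<in> borel_measurable M"
      using X by (intro borel_measurable_sum measurable_compose[OF X] borel_measurable_indicator) auto
    then show "{w \<in> space M. order_stat (\<lambda>i. X i w) n k \<le> z} \<in> events"
      unfolding eq by measurable
  qed
qed

lemma prob_Inter_uniform:
  fixes X :: "nat \<Rightarrow> 'a \<Rightarrow> real"
  assumes indep: "indep_vars (\<lambda>_. borel) X {1..n}" and "1 \<le> n"
    and unif: "\<And>i. i \<in> {1..n} \<Longrightarrow> distr M borel (X i) = uniform_measure lborel {0..1::real}"
    and A: "\<And>i. i \<in> {1..n} \<Longrightarrow> A i \<in> sets borel"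
  shows "(\<Inter>i\<in>{1..n}. X i -` A i \<inter> space M) \<in> events"
    "prob (\<Inter>i\<in>{1..n}. X i -` A i \<inter> space M) = (\<Prod>i\<in>{1..n}. measure lborel ({0..1} \<inter> A i))"
proof -
  have X: "X i \<in> borel_measurable M" if "i \<in> {1..n}" for i
    using indep that by (auto simp: indep_vars_def)
  show "(\<Inter>i\<in>{1..n}. X i -` A i \<inter> space M) \<in> events"
    using \<open>1 \<le> n\<close> by (intro sets.finite_INT measurable_sets[OF X] A) auto
  have "prob (\<Inter>i\<in>{1..n}. X i -` A i \<inter> space M) = (\<Prod>i\<in>{1..n}. prob (X i -` A i \<inter> space M))"
    using \<open>1 \<le> n\<close> by (intro indep_varsD_finite[OF indep] A) auto
  also have "\<dots> = (\<Prod>i\<in>{1..n}. measure lborel ({0..1} \<inter> A i))"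
    by (intro prod.cong refl prob_uniform X unif A)
  finally show "prob (\<Inter>i\<in>{1..n}. X i -` A i \<inter> space M) = (\<Prod>i\<in>{1..n}. measure lborel ({0..1} \<inter> A i))" .
qed

lemma prob_order_stat_le:
  assumes indep: "indep_vars (\<lambda>_. borel) X {1..n}"
    and unif: "\<And>i. i \<in> {1..n} \<Longrightarrow> distr M borel (X i) = uniform_measure lborel {0..1::real}"
    and k: "1 \<le> k" "k \<le> n" and ab: "0 \<le> b" "a \<le> 1"
  shows "prob {\<omega> \<in> space M. order_stat (\<lambda>i. X i \<omega>) n k \<in> {a<..<b}}
    \<le> real (n choose k) * b ^ k * (1 - a) ^ (n - k)"
proof -
  define KS where "KS = {K. K \<subseteq> {1..n} \<and> card K = k}"
  define A where "A K i = (if i \<in> K then {..<b} else {a<..})" for K and i :: nat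
  define E where "E K = (\<Inter>i\<in>{1..n}. X i -` A K i \<inter> space M)" for K
  have "1 \<le> n" using k by simp
  have mA: "A K i \<in> sets borel" for K i by (simp add: A_def)
  note E = prob_Inter_uniform[where A = "A _", OF indep \<open>1 \<le> n\<close> unif mA, folded E_def]
  have "finite KS" by (rule finite_subset[of _ "Pow {1..n}"]) (auto simp: KS_def)
  have "{\<omega> \<in> space M. order_stat (\<lambda>i. X i \<omega>) n k \<in> {a<..<b}} \<subseteq> (\<Union>K\<in>KS. E K)"
  proof
    fix \<omega> assume "\<omega> \<in> {\<omega> \<in> space M. order_stat (\<lambda>i. X i \<omega>) n k \<in> {a<..<b}}"
    then have \<omega>: "\<omega> \<in> space M" "a < order_stat (\<lambda>i. X i \<omega>) n k" "order_stat (\<lambda>i. X i \<omega>) n k < b" by auto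
    have 1: "card {i \<in> {1..n}. X i \<omega> \<le> a} \<le> k"
      using \<omega>(2) order_stat_iff_card[OF k, of "\<lambda>x. x \<le> a" "\<lambda>i. X i \<omega>"] by auto
    have 2: "k \<le> card {i \<in> {1..n}. X i \<omega> < b}"
      using \<omega>(3) order_stat_iff_card[OF k, of "\<lambda>x. x < b" "\<lambda>i. X i \<omega>"] by auto
    \<comment> \<open>The set \<open>K\<close> is squeezed between the indices with value at most
      \<open>a\<close> and those with value below \<open>b\<close>, so it can be given exactly
      \<open>k\<close> elements; the indices outside \<open>K\<close> then have values above
      \<open>a\<close>.\<close>
    have "{i \<in> {1..n}. X i \<omega> \<le> a} \<subseteq> {i \<in> {1..n}. X i \<omega> < b}" using \<omega> by auto
    from exists_subset_between[OF 1 2 this] obtain K where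
      K: "{i \<in> {1..n}. X i \<omega> \<le> a} \<subseteq> K" "K \<subseteq> {i \<in> {1..n}. X i \<omega> < b}" "card K = k" by auto
    then have "K \<in> KS" by (auto simp: KS_def)
    moreover have "\<omega> \<in> E K"
      unfolding E_def A_def using K \<omega>(1) \<open>1 \<le> n\<close> by (auto simp: not_le[symmetric])
    ultimately show "\<omega> \<in> (\<Union>K\<in>KS. E K)" by blast
  qed
  then have "prob {\<omega> \<in> space M. order_stat (\<lambda>i. X i \<omega>) n k \<in> {a<..<b}} \<le> prob (\<Union>K\<in>KS. E K)"
    using E(1) \<open>finite KS\<close> by (intro finite_measure_mono sets.finite_UN) auto
  also have "\<dots> \<le> (\<Sum>K\<in>KS. prob (E K))"
    using E(1) \<open>finite KS\<close> by (intro measure_UNION_le) auto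
  also have "\<dots> \<le> (\<Sum>K\<in>KS. b ^ k * (1 - a) ^ (n - k))"
  proof (rule sum_mono)
    fix K assume "K \<in> KS"
    then have K: "K \<subseteq> {1..n}" "card K = k" by (auto simp: KS_def)
    \<comment> \<open>Only inequalities are available, because \<open>b\<close> may exceed 1 and
      \<open>a\<close> may be negative.\<close>
    have "measure lborel ({0..1} \<inter> {..<b}) \<le> measure lborel {0..b}"
      using ab by (intro measure_mono_fmeasurable) (auto intro!: fmeasurableI simp: emeasure_lborel_Icc_eq)
    moreover have "measure lborel ({0..1} \<inter> {a<..}) \<le> measure lborel {a..1}"
      using ab by (intro measure_mono_fmeasurable) (auto intro!: fmeasurableI simp: emeasure_lborel_Icc_eq)
    ultimately have m: "measure lborel ({0..1} \<inter> A K i) \<le> (if i \<in> K then b else 1 - a)" for i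
      using ab by (simp add: A_def)
    have "prob (E K) = (\<Prod>i\<in>{1..n}. measure lborel ({0..1} \<inter> A K i))"
      by (simp only: E(2))
    also have "\<dots> \<le> (\<Prod>i\<in>{1..n}. if i \<in> K then b else 1 - a)"
      by (intro prod_mono conjI measure_nonneg m)
    also have "\<dots> = b ^ card ({1..n} \<inter> K) * (1 - a) ^ card ({1..n} - K)"
      by (subst prod.If_cases) (auto simp: Diff_eq Int_def Collect_neg_eq)
    also have "\<dots> = b ^ k * (1 - a) ^ (n - k)"
      using K by (simp add: Int_absorb1 card_Diff_subset finite_subset)
    finally show "prob (E K) \<le> b ^ k * (1 - a) ^ (n - k)" .
  qed
  also have "\<dots> = real (n choose k) * b ^ k * (1 - a) ^ (n - k)"
    using n_subsets[of "{1..n}" k] by (simp add: KS_def)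
  finally show ?thesis .
qed

text \<open>Variable \<open>n\<close> is made the \<open>k\<close>-th smallest: it lies in the
  interval, \<open>k - 1\<close> of the others are at most \<open>a\<close> and the rest at least
  \<open>b\<close>. Prescribing which variable falls in the interval costs at most a factor
  \<open>n\<close>, and the events for different index sets are disjoint, so that their
  probabilities add.\<close>

lemma prob_order_stat_ge:
  assumes indep: "indep_vars (\<lambda>_. borel) X {1..n}"
    and unif: "\<And>i. i \<in> {1..n} \<Longrightarrow> distr M borel (X i) = uniform_measure lborel {0..1::real}"
    and k: "1 \<le> k" "k \<le> n" and ab: "0 \<le> a" "a \<le> b" "b \<le> 1"
  shows "real ((n - 1) choose (k - 1)) * a ^ (k - 1) * (1 - b) ^ (n - k) * (b - a)
    \<le> prob {\<omega> \<in> space M. order_stat (\<lambda>i. X i \<omega>) n k \<in> {a<..<b}}"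
proof -
  define KS where "KS = {K. K \<subseteq> {1..<n} \<and> card K = k - 1}"
  define A where "A K i = (if i = n then {a<..<b} else if i \<in> K then {..a} else {b..})" for K and i :: nat
  define E where "E K = (\<Inter>i\<in>{1..n}. X i -` A K i \<inter> space M)" for K
  have "1 \<le> n" using k by simp
  have mA: "A K i \<in> sets borel" for K i by (simp add: A_def)
  note E = prob_Inter_uniform[where A = "A _", OF indep \<open>1 \<le> n\<close> unif mA, folded E_def]
  have X: "X i \<in> borel_measurable M" if "i \<in> {1..n}" for i
    using indep that by (auto simp: indep_vars_def)
  have "finite KS" by (rule finite_subset[of _ "Pow {1..<n}"]) (auto simp: KS_def)
  have EK: "\<omega> \<in> space M \<and> X n \<omega> \<in> {a<..<b} \<and> (\<forall>i\<in>K. X i \<omega> \<le> a) \<and> (\<forall>i\<in>{1..<n} - K. b \<le> X i \<omega>)"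
    if "\<omega> \<in> E K" "K \<in> KS" for \<omega> K
  proof -
    have *: "\<omega> \<in> space M \<and> X i \<omega> \<in> A K i" if "i \<in> {1..n}" for i
      using \<open>\<omega> \<in> E K\<close> that by (auto simp: E_def)
    have "X i \<omega> \<le> a" if "i \<in> K" for i
      using *[of i] that \<open>K \<in> KS\<close> by (auto simp: A_def KS_def split: if_splits)
    moreover have "b \<le> X i \<omega>" if "i \<in> {1..<n} - K" for i
      using *[of i] that by (auto simp: A_def split: if_splits)
    moreover have "X n \<omega> \<in> {a<..<b}" "\<omega> \<in> space M" using *[of n] \<open>1 \<le> n\<close> by (auto simp: A_def)
    ultimately show ?thesis by blast
  qed
  have "real ((n - 1) choose (k - 1)) * a ^ (k - 1) * (1 - b) ^ (n - k) * (b - a)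
      = (\<Sum>K\<in>KS. a ^ (k - 1) * (1 - b) ^ (n - k) * (b - a))"
    using n_subsets[of "{1..<n}" "k - 1"] by (simp add: KS_def)
  also have "\<dots> = (\<Sum>K\<in>KS. prob (E K))"
  proof (rule sum.cong[OF refl])
    fix K assume "K \<in> KS"
    then have K: "K \<subseteq> {1..<n}" "card K = k - 1" by (auto simp: KS_def)
    have "{0..1} \<inter> {a<..<b} = {a<..<b}" "{0..1} \<inter> {..a} = {0..a}" "{0..1} \<inter> {b..} = {b..1}"
      using ab by auto
    then have m: "measure lborel ({0..1} \<inter> A K i) = (if i = n then b - a else if i \<in> K then a else 1 - b)" for i
      using ab by (simp add: A_def)
    have ins: "{1..n} = insert n {1..<n}" using \<open>1 \<le> n\<close> by auto
    have "prob (E K) = (\<Prod>i\<in>{1..n}. if i = n then b - a else if i \<in> K then a else 1 - b)"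
      by (simp only: E(2) m)
    also have "\<dots> = (b - a) * (\<Prod>i\<in>{1..<n}. if i = n then b - a else if i \<in> K then a else 1 - b)"
      unfolding ins by (subst prod.insert) auto
    also have "(\<Prod>i\<in>{1..<n}. if i = n then b - a else if i \<in> K then a else 1 - b)
        = (\<Prod>i\<in>{1..<n}. if i \<in> K then a else 1 - b)"
      by (intro prod.cong) auto
    also have "\<dots> = a ^ card ({1..<n} \<inter> K) * (1 - b) ^ card ({1..<n} - K)"
      by (subst prod.If_cases) (auto simp: Diff_eq Int_def Collect_neg_eq)
    also have "\<dots> = a ^ (k - 1) * (1 - b) ^ (n - k)"
    proof -
      have "card ({1..<n} - K) = n - k"
        using K k by (simp add: card_Diff_subset finite_subset)
      then show ?thesis using K by (simp add: Int_absorb1)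
    qed
    finally show "a ^ (k - 1) * (1 - b) ^ (n - k) * (b - a) = prob (E K)" by simp
  qed
  also have "\<dots> = prob (\<Union>K\<in>KS. E K)"
  proof (rule finite_measure_finite_Union[symmetric])
    show "disjoint_family_on E KS"
      unfolding disjoint_family_on_def
    proof (intro ballI impI, rule ccontr)
      fix K L assume KL: "K \<in> KS" "L \<in> KS" "K \<noteq> L" "E K \<inter> E L \<noteq> {}"
      then obtain \<omega> where \<omega>: "\<omega> \<in> E K" "\<omega> \<in> E L" by auto
      have fin: "finite K" "finite L" using KL by (auto simp: KS_def intro: finite_subset)
      \<comment> \<open>Distinct sets of equal size are not nested, so some variable would have to
        be both at most \<open>a\<close> and at least \<open>b\<close>.\<close>
      have "\<not> K \<subseteq> L" using KL fin card_subset_eq[of L K] by (auto simp: KS_def)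
      then obtain i where i: "i \<in> K" "i \<notin> L" by auto
      then have "i \<in> {1..<n}" using KL by (auto simp: KS_def)
      \<comment> \<open>Only \<open>a \<le> b\<close> is assumed; the strict inequality comes from
        variable \<open>n\<close> lying in the open interval.\<close>
      then show False using EK[OF \<omega>(1) KL(1)] EK[OF \<omega>(2) KL(2)] i ab by force
    qed
  qed (use E(1) \<open>finite KS\<close> in auto)
  also have "\<dots> \<le> prob {\<omega> \<in> space M. order_stat (\<lambda>i. X i \<omega>) n k \<in> {a<..<b}}"
  proof (rule finite_measure_mono)
    show "(\<Union>K\<in>KS. E K) \<subseteq> {\<omega> \<in> space M. order_stat (\<lambda>i. X i \<omega>) n k \<in> {a<..<b}}"
    proof
      fix \<omega> assume "\<omega> \<in> (\<Union>K\<in>KS. E K)"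
      then obtain K where K: "K \<in> KS" "\<omega> \<in> E K" by auto
      note \<omega> = EK[OF K(2,1)]
      have Ks: "K \<subseteq> {1..<n}" "card K = k - 1" "finite K"
        using K by (auto simp: KS_def intro: finite_subset)
      have "{i \<in> {1..n}. X i \<omega> \<le> a} \<subseteq> K"
      proof
        fix i assume i: "i \<in> {i \<in> {1..n}. X i \<omega> \<le> a}"
        then have "i \<noteq> n" using \<omega> by auto
        then have "i \<in> {1..<n}" using i by auto
        then show "i \<in> K" using \<omega> i by force
      qed
      then have "card {i \<in> {1..n}. X i \<omega> \<le> a} \<le> k - 1" using Ks card_mono by metis
      then have 1: "\<not> order_stat (\<lambda>i. X i \<omega>) n k \<le> a"
        using k order_stat_iff_card[OF k, of "\<lambda>x. x \<le> a" "\<lambda>i. X i \<omega>"] by auto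
      have "insert n K \<subseteq> {i \<in> {1..n}. X i \<omega> < b}" using \<omega> Ks \<open>1 \<le> n\<close> by force
      then have "card (insert n K) \<le> card {i \<in> {1..n}. X i \<omega> < b}" by (intro card_mono) auto
      moreover have "card (insert n K) = k" using Ks k by (subst card_insert_disjoint) auto
      ultimately have 2: "order_stat (\<lambda>i. X i \<omega>) n k < b"
        using order_stat_iff_card[OF k, of "\<lambda>x. x < b" "\<lambda>i. X i \<omega>"] by auto
      show "\<omega> \<in> {\<omega> \<in> space M. order_stat (\<lambda>i. X i \<omega>) n k \<in> {a<..<b}}" using 1 2 \<omega> by auto
    qed
    have [measurable]: "(\<lambda>\<omega>. order_stat (\<lambda>i. X i \<omega>) n k) \<in> borel_measurable M"
      by (intro measurable_order_stat X k)
    show "{\<omega> \<in> space M. order_stat (\<lambda>i. X i \<omega>) n k \<in> {a<..<b}} \<in> events" by measurable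
  qed
  finally show ?thesis .
qed

end

text \<open>For positive z the expression is \<open>xlog_ratio c z\<close>, written as in the limit
  of \<open>tendsto_ln_binomial_weight\<close>. If \<open>c > 0\<close>, a finite upper bound forces
  \<open>d > 0\<close>, and \<open>ln\<close> is continuous there.\<close>

lemma xlog_ratio_less_eventually:
  assumes "0 \<le> c" "0 \<le> d" "xlog_ratio c d < ereal r"
  shows "\<forall>\<^sub>F z in nhds d. c * ln c - c * ln z < r"
proof (cases "c = 0")
  case True
  then show ?thesis using assms by (simp add: xlog_ratio_def zero_ereal_def)
next
  case False
  then have d: "0 < d" using assms by (auto simp: xlog_ratio_def split: if_splits)
  then have "((\<lambda>z. c * ln c - c * ln z) \<longlongrightarrow> c * ln c - c * ln d) (nhds d)"
    by (intro tendsto_intros filterlim_ident) auto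
  moreover have "c * ln c - c * ln d < r"
    using assms False d by (simp add: xlog_ratio_def ln_div algebra_simps)
  ultimately show ?thesis by (rule order_tendstoD)
qed

text \<open>The point \<open>z\<close> is strictly larger than \<open>d\<close> so that it bounds an
  open neighbourhood of the point under study. If \<open>d = 0\<close> and \<open>c > 0\<close>, the
  expression is unbounded as z decreases to 0.\<close>

lemma less_xlog_ratio_ex:
  assumes "0 \<le> c" "0 \<le> d" "ereal r < xlog_ratio c d"
  shows "\<exists>z>d. r < c * ln c - c * ln z"
proof (cases "c = 0")
  case True
  then show ?thesis using assms by (auto simp: xlog_ratio_def zero_ereal_def intro: gt_ex)
next
  case c: False
  show ?thesis
  proof (cases "d = 0")
    case True
    \<comment> \<open>The solution of \<open>c * ln c - c * ln z = r + 1\<close>.\<close>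
    define z where "z = exp (ln c - (r + 1) / c)"
    have "c * ((r + 1) / c) = r + 1" using c by simp
    then have "c * ln c - c * ln z = r + 1" by (simp add: z_def right_diff_distrib)
    then show ?thesis using True by (intro exI[of _ z]) (auto simp: z_def)
  next
    case False
    then have d: "0 < d" using assms by simp
    then have "((\<lambda>z. c * ln c - c * ln z) \<longlongrightarrow> c * ln c - c * ln d) (at_right d)"
      by (intro tendsto_intros) auto
    moreover have "r < c * ln c - c * ln d"
      using assms c d by (simp add: xlog_ratio_def ln_div algebra_simps)
    ultimately have "\<forall>\<^sub>F z in at_right d. r < c * ln c - c * ln z" by (rule order_tendstoD)
    moreover have "\<forall>\<^sub>F z in at_right d. d < z" by (simp add: eventually_at_right_less)
    ultimately have "\<forall>\<^sub>F z in at_right d. d < z \<and> r < c * ln c - c * ln z" by eventually_elim simp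
    then show ?thesis using eventually_happens'[OF trivial_limit_at_right_real] by blast
  qed
qed

lemma xlog_ratio_not_MInf: "xlog_ratio c d \<noteq> -\<infinity>"
  by (simp add: xlog_ratio_def)

section \<open>Local bounds for \<open>T_proc\<close>\<close>

context prob_space
begin

lemma local_LDP_T_proc:
  assumes t: "0 < t" "t \<le> 1"
    and indep: "\<And>n. 1 \<le> n \<Longrightarrow> indep_vars (\<lambda>_. borel) (U n) {1..n}"
    and unif: "\<And>n i. 1 \<le> n \<Longrightarrow> i \<in> {1..n} \<Longrightarrow>
      distr M borel (U n i) = uniform_measure lborel {0..1::real}"
  shows "local_LDP M (T_proc U t) (\<lambda>x. if x \<in> {0..1} then I_rate t x else \<infinity>)"
proof -
  define k where "k n = nat \<lfloor>real n * t\<rfloor>" for n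
  have kn: "k n \<le> n" for n unfolding k_def using t(2) by (rule nat_floor_mult_le)
  have T: "T_proc U t n = (\<lambda>\<omega>. order_stat (\<lambda>i. U n i \<omega>) n (k n))" for n
    by (simp add: T_proc_def k_def fun_eq_iff)
  have U: "U n i \<in> borel_measurable M" if "i \<in> {1..n}" for n i
    using indep[of n] that by (auto simp: indep_vars_def)
  have meas: "T_proc U t n \<in> borel_measurable M" for n
    unfolding T by (intro measurable_order_stat U kn)
  have "filterlim (\<lambda>n. t * real n) at_top sequentially"
    using t by (intro filterlim_tendsto_pos_mult_at_top[OF tendsto_const] filterlim_real_sequentially) auto
  then have "\<forall>\<^sub>F n in sequentially. 1 \<le> t * real n" by (simp add: filterlim_at_top)
  \<comment> \<open>Here \<open>0 < t\<close> matters: from some \<open>n\<close> on, the order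
    statistic is one of the uniform variables and not the conventional value 0.\<close>
  then have k1: "\<forall>\<^sub>F n in sequentially. 1 \<le> k n"
    by eventually_elim (simp add: k_def mult.commute le_nat_iff)
  have outside: "\<forall>\<^sub>F n in sequentially. prob {\<omega> \<in> space M. T_proc U t n \<omega> \<notin> {0..1}} \<le> 0"
    using k1
  proof eventually_elim
    case (elim n)
    have "prob {\<omega> \<in> space M. T_proc U t n \<omega> \<notin> {0..1}} \<le> prob (\<Union>i\<in>{1..n}. U n i -` (- {0..1}) \<inter> space M)"
    proof (rule finite_measure_mono)
      show "{\<omega> \<in> space M. T_proc U t n \<omega> \<notin> {0..1}} \<subseteq> (\<Union>i\<in>{1..n}. U n i -` (- {0..1}) \<inter> space M)"
      proof
        fix \<omega> assume \<omega>: "\<omega> \<in> {\<omega> \<in> space M. T_proc U t n \<omega> \<notin> {0..1}}"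
        obtain i where "i \<in> {1..n}" "T_proc U t n \<omega> = U n i \<omega>"
          using order_stat_in_image[OF elim kn, of "\<lambda>i. U n i \<omega>"] by (auto simp: T)
        then show "\<omega> \<in> (\<Union>i\<in>{1..n}. U n i -` (- {0..1}) \<inter> space M)" using \<omega> by auto
      qed
    qed (intro sets.finite_UN measurable_sets[OF U], auto)
    also have "\<dots> \<le> (\<Sum>i\<in>{1..n}. prob (U n i -` (- {0..1}) \<inter> space M))"
      by (intro measure_UNION_le measurable_sets[OF U]) auto
    also have "\<dots> = (\<Sum>i\<in>{1..n}. measure lborel ({0..1::real} \<inter> - {0..1}))"
      by (intro sum.cong refl prob_uniform U unif) auto
    finally show ?case by simp
  qed
  show ?thesis
    unfolding local_LDP_def
  proof (intro conjI allI impI)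
    fix x r assume r: "ereal r < (if x \<in> {0..1} then I_rate t x else \<infinity>)"
    show "\<exists>A. open A \<and> x \<in> A \<and>
        (\<forall>\<^sub>F n in sequentially. prob {\<omega> \<in> space M. T_proc U t n \<omega> \<in> A} \<le> exp (- (r * real n)))"
    proof (cases "x \<in> {0..1}")
      case True
      then have "ereal r < xlog_ratio t x + xlog_ratio (1 - t) (1 - x)" using r by (simp add: I_rate_def)
      from ereal_less_add_split[OF this xlog_ratio_not_MInf xlog_ratio_not_MInf] obtain u v
        where uv: "ereal u < xlog_ratio t x" "ereal v < xlog_ratio (1 - t) (1 - x)" "r < u + v" by blast
      \<comment> \<open>The two terms of the rate are treated separately: \<open>b\<close> exceeds
        \<open>x\<close> and \<open>c\<close> exceeds \<open>1 - x\<close>, so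
        \<open>{1 - c<..<b}\<close> is a neighbourhood of \<open>x\<close>.\<close>
      from less_xlog_ratio_ex[OF _ _ uv(1)] obtain b where b: "x < b" "u < t * ln t - t * ln b"
        using t True by auto
      from less_xlog_ratio_ex[OF _ _ uv(2)] obtain c where
        c: "1 - x < c" "v < (1 - t) * ln (1 - t) - (1 - t) * ln c"
        using t True by auto
      have pos: "0 < b" "0 < c" using b c True by auto
      define f where "f n = real (n choose k n) * b ^ k n * c ^ (n - k n) * 1" for n
      have "\<forall>\<^sub>F n in sequentially. f n \<le> exp (- (r * real n))"
      proof (rule eventually_le_exp)
        show "(\<lambda>n. ln (f n) / real n) \<longlonglongrightarrow> (t * ln b - t * ln t) + ((1 - t) * ln c - (1 - t) * ln (1 - t))"
          unfolding f_def by (intro tendsto_ln_binomial_weight[OF t k_def pos tendsto_const]) simp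
        show "(t * ln b - t * ln t) + ((1 - t) * ln c - (1 - t) * ln (1 - t)) < - r"
          using uv b c by linarith
        show "\<forall>\<^sub>F n in sequentially. 0 < f n"
          using pos kn by (simp add: f_def zero_less_binomial)
      qed
      then have "\<forall>\<^sub>F n in sequentially. prob {\<omega> \<in> space M. T_proc U t n \<omega> \<in> {1 - c<..<b}} \<le> exp (- (r * real n))"
        using k1
      proof eventually_elim
        case (elim n)
        have n: "1 \<le> n" using elim(2) kn[of n] by linarith
        have "prob {\<omega> \<in> space M. T_proc U t n \<omega> \<in> {1 - c<..<b}} \<le> f n"
          using prob_order_stat_le[OF indep[OF n] unif[OF n] elim(2) kn, of b "1 - c"] pos
          by (simp add: T f_def)
        then show ?case using elim by linarith
      qed
      then show ?thesis using b c by (intro exI[of _ "{1 - c<..<b}"]) auto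
    next
      case False
      have "\<forall>\<^sub>F n in sequentially. prob {\<omega> \<in> space M. T_proc U t n \<omega> \<in> - {0..1}} \<le> exp (- (r * real n))"
        using outside
      proof eventually_elim
        case (elim n)
        then have "prob {\<omega> \<in> space M. T_proc U t n \<omega> \<in> - {0..1}} \<le> 0" by simp
        then show ?case using exp_ge_zero order_trans by blast
      qed
      then show ?thesis using False by (intro exI[of _ "- {0..1}"]) (auto intro: open_Compl)
    qed
  next
    fix x r and A :: "real set"
    assume r: "(if x \<in> {0..1} then I_rate t x else \<infinity>) < ereal r" and A: "open A" "x \<in> A"
    then have x: "0 \<le> x" "x \<le> 1" and "xlog_ratio t x + xlog_ratio (1 - t) (1 - x) < ereal r"
      by (auto simp: I_rate_def split: if_splits)
    from ereal_add_less_split[OF this(3) xlog_ratio_not_MInf xlog_ratio_not_MInf] obtain u v where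
      uv: "xlog_ratio t x < ereal u" "xlog_ratio (1 - t) (1 - x) < ereal v" "u + v = r" by blast
    have "\<forall>\<^sub>F z in nhds x. t * ln t - t * ln z < u"
      using t x uv by (intro xlog_ratio_less_eventually) auto
    moreover have "\<forall>\<^sub>F z in nhds (1 - x). (1 - t) * ln (1 - t) - (1 - t) * ln z < v"
      using t x uv by (intro xlog_ratio_less_eventually) auto
    then have "\<forall>\<^sub>F z in nhds x. (1 - t) * ln (1 - t) - (1 - t) * ln (1 - z) < v"
      by (rule eventually_compose_filterlim) (intro tendsto_intros filterlim_ident)
    moreover have "\<forall>\<^sub>F z in nhds x. z \<in> A" using A by (intro eventually_nhds_in_open)
    ultimately have "\<forall>\<^sub>F z in nhds x. z \<in> A \<and> t * ln t - t * ln z < u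
        \<and> (1 - t) * ln (1 - t) - (1 - t) * ln (1 - z) < v"
      by eventually_elim auto
    then obtain e where e: "0 < e" "\<And>z. dist z x < e \<Longrightarrow> z \<in> A \<and> t * ln t - t * ln z < u
        \<and> (1 - t) * ln (1 - t) - (1 - t) * ln (1 - z) < v"
      by (auto simp: eventually_nhds_metric)
    \<comment> \<open>Clipping to the unit interval allows \<open>x\<close> to be an endpoint. The
      interval from \<open>a\<close> to \<open>b\<close> lies near \<open>x\<close> but need not
      contain it; what counts is \<open>0 < a\<close> and \<open>b < 1\<close>, which keep the
      powers in \<open>f\<close> positive.\<close>
    define l where "l = max 0 (x - e)"
    define h where "h = min 1 (x + e)"
    have "l < h" using e x by (auto simp: l_def h_def)
    then obtain a where a: "l < a" "a < h" using dense by blast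
    then obtain b where b: "a < b" "b < h" using dense by blast
    have ab: "0 < a" "a < b" "b < 1" using a b by (auto simp: l_def h_def)
    have near: "dist z x < e" if "a \<le> z" "z \<le> b" for z
      using that a b by (auto simp: l_def h_def dist_real_def)
    \<comment> \<open>The last factor converts the finite bound:
      \<open>((n - 1) choose (k - 1)) * a ^ (k - 1)\<close> equals
      \<open>(k / n) * (n choose k) * a ^ k / a\<close>.\<close>
    define f where "f n = real (n choose k n) * a ^ k n * (1 - b) ^ (n - k n) *
      (real (k n) / real n * ((b - a) / a))" for n
    have "\<forall>\<^sub>F n in sequentially. exp (- (r * real n)) \<le> f n"
    proof (rule eventually_ge_exp)
      show "(\<lambda>n. ln (f n) / real n) \<longlonglongrightarrow>
          (t * ln a - t * ln t) + ((1 - t) * ln (1 - b) - (1 - t) * ln (1 - t))"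
        unfolding f_def
      proof (rule tendsto_ln_binomial_weight[OF t k_def])
        show "(\<lambda>n. real (k n) / real n * ((b - a) / a)) \<longlonglongrightarrow> t * ((b - a) / a)"
          unfolding k_def using t by (intro tendsto_mult tendsto_floor_ratio tendsto_const) simp
      qed (use ab t in auto)
      show "- r < (t * ln a - t * ln t) + ((1 - t) * ln (1 - b) - (1 - t) * ln (1 - t))"
        using e(2)[OF near[of a]] e(2)[OF near[of b]] ab uv(3) by linarith
      show "\<forall>\<^sub>F n in sequentially. 0 < f n"
        using k1
      proof eventually_elim
        case (elim n)
        then show ?case using ab kn[of n] by (simp add: f_def zero_less_binomial)
      qed
    qed
    then show "\<forall>\<^sub>F n in sequentially. exp (- (r * real n)) \<le> prob {\<omega> \<in> space M. T_proc U t n \<omega> \<in> A}"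
      using k1
    proof eventually_elim
      case (elim n)
      have n: "1 \<le> n" using elim(2) kn[of n] by linarith
      have "real (k n) * real (n choose k n) = real n * real (n - 1 choose (k n - 1))"
        using times_binomial_minus1_eq[of "k n" n] elim(2) by (simp flip: of_nat_mult)
      then have "real (k n) / real n * real (n choose k n) = real (n - 1 choose (k n - 1))"
        using n by (simp add: field_simps)
      moreover have "a ^ k n / a = a ^ (k n - 1)"
        using elim(2) ab by (simp add: power_diff)
      moreover have "f n = (real (k n) / real n * real (n choose k n)) * (a ^ k n / a) * (1 - b) ^ (n - k n) * (b - a)"
        by (simp add: f_def)
      ultimately have "f n = real (n - 1 choose (k n - 1)) * a ^ (k n - 1) * (1 - b) ^ (n - k n) * (b - a)"
        by simp
      also have "\<dots> \<le> prob {\<omega> \<in> space M. order_stat (\<lambda>i. U n i \<omega>) n (k n) \<in> {a<..<b}}"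
        using ab by (intro prob_order_stat_ge[OF indep[OF n] unif[OF n] elim(2) kn]) auto
      also have "\<dots> \<le> prob {\<omega> \<in> space M. T_proc U t n \<omega> \<in> A}"
      proof (rule finite_measure_mono)
        have [measurable]: "T_proc U t n \<in> borel_measurable M" by (rule meas)
        have [measurable]: "A \<in> sets borel" using A by (intro borel_open)
        show "{\<omega> \<in> space M. T_proc U t n \<omega> \<in> A} \<in> events" by measurable
      qed (use e(2)[OF near] in \<open>auto simp: T\<close>)
      finally show ?case using elim by linarith
    qed
  next
    fix r
    have "\<forall>\<^sub>F n in sequentially. prob {\<omega> \<in> space M. T_proc U t n \<omega> \<notin> {0..1}} \<le> exp (- (r * real n))"
      using outside by eventually_elim (rule order_trans[OF _ exp_ge_zero])
    then show "\<exists>K. compact K \<and>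
        (\<forall>\<^sub>F n in sequentially. prob {\<omega> \<in> space M. T_proc U t n \<omega> \<notin> K} \<le> exp (- (r * real n)))"
      by (intro exI[of _ "{0..1}"]) auto
  qed (rule meas)
qed

end

section \<open>Cramer's theorem for partial sums\<close>

lemma exp_le_quadratic:
  fixes x :: real
  assumes "\<bar>x\<bar> \<le> 1"
  shows "exp x \<le> 1 + x + x\<^sup>2"
proof (cases "0 \<le> x")
  case True
  then show ?thesis using assms exp_bound[of x] by simp
next
  case False
  then have "1 - x \<le> exp (- x)" using exp_ge_add_one_self[of "- x"] by simp
  then have "exp x * (1 - x) \<le> exp x * exp (- x)" by (intro mult_left_mono) auto
  also have "\<dots> = 1" by (simp add: mult_exp_exp)
  \<comment> \<open>The right-hand side is 1 minus the cube of \<open>x\<close>, and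
    \<open>x\<close> is negative.\<close>
  also have "1 \<le> (1 + x + x\<^sup>2) * (1 - x)"
  proof -
    have "x * x\<^sup>2 \<le> 0" using False by (simp add: mult_nonpos_nonneg)
    then show ?thesis by (simp add: algebra_simps power2_eq_square)
  qed
  finally show ?thesis using False by simp
qed

section \<open>Truncated moment generating functions\<close>

context prob_space
begin

text \<open>The truncation is not renormalised: this is the generating function of a sub-probability
  measure. So it increases with \<open>R\<close>, and integrals of products of truncated
  exponentials still factorise.\<close>

definition trunc_mgf :: "('a \<Rightarrow> real) \<Rightarrow> real \<Rightarrow> real \<Rightarrow> real" where
  "trunc_mgf W R \<theta> = expectation (\<lambda>\<omega>. exp (\<theta> * W \<omega>) * indicator {-R..R} (W \<omega>))"

lemma integrable_trunc:
  fixes g :: "real \<Rightarrow> real"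
  assumes [measurable]: "W \<in> borel_measurable M" "g \<in> borel_measurable borel"
    and "\<And>w. \<bar>w\<bar> \<le> R \<Longrightarrow> \<bar>g w\<bar> \<le> B"
  shows "integrable M (\<lambda>\<omega>. g (W \<omega>) * indicator {-R..R} (W \<omega>))"
proof (rule integrable_const_bound[where B = "max B 0"])
  show "AE \<omega> in M. norm (g (W \<omega>) * indicator {-R..R} (W \<omega>)) \<le> max B 0"
  proof (rule AE_I2)
    fix \<omega>
    show "norm (g (W \<omega>) * indicator {-R..R} (W \<omega>)) \<le> max B 0"
    proof (cases "W \<omega> \<in> {-R..R}")
      case True
      then have "\<bar>g (W \<omega>)\<bar> \<le> B" by (intro assms(3)) auto
      then show ?thesis using True by simp
    qed simp
  qed
qed measurable

lemma exp_trunc_le: "\<bar>w\<bar> \<le> R \<Longrightarrow> exp (\<theta> * w) \<le> exp (\<bar>\<theta>\<bar> * (R::real))"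
proof -
  assume "\<bar>w\<bar> \<le> R"
  have "\<theta> * w \<le> \<bar>\<theta>\<bar> * \<bar>w\<bar>" using abs_ge_self[of "\<theta> * w"] by (simp add: abs_mult)
  also have "\<dots> \<le> \<bar>\<theta>\<bar> * R" using \<open>\<bar>w\<bar> \<le> R\<close> by (intro mult_left_mono) auto
  finally show ?thesis by simp
qed

lemma integrable_trunc_mgf:
  fixes W :: "'a \<Rightarrow> real"
  assumes "W \<in> borel_measurable M"
  shows "integrable M (\<lambda>\<omega>. exp (\<theta> * W \<omega>) * indicator {-R..R} (W \<omega>))"
  by (rule integrable_trunc[OF assms, where B = "exp (\<bar>\<theta>\<bar> * R)"]) (simp_all only: abs_exp_cancel exp_trunc_le, measurable)

lemma trunc_mgf_nonneg: "0 \<le> trunc_mgf W R \<theta>"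
  unfolding trunc_mgf_def by (intro Bochner_Integration.integral_nonneg) auto

lemma nn_integral_trunc_mgf:
  assumes "W \<in> borel_measurable M"
  shows "(\<integral>\<^sup>+\<omega>. ennreal (exp (\<theta> * W \<omega>) * indicator {-R..R} (W \<omega>)) \<partial>M) = ennreal (trunc_mgf W R \<theta>)"
  unfolding trunc_mgf_def by (intro nn_integral_eq_integral integrable_trunc_mgf assms) auto

lemma trunc_mgf_shift_le:
  assumes "W \<in> borel_measurable M"
  shows "trunc_mgf W R (\<theta> + \<eta>) \<le> exp (\<bar>\<eta>\<bar> * R) * trunc_mgf W R \<theta>"
proof -
  have "trunc_mgf W R (\<theta> + \<eta>)
      \<le> expectation (\<lambda>\<omega>. exp (\<bar>\<eta>\<bar> * R) * (exp (\<theta> * W \<omega>) * indicator {-R..R} (W \<omega>)))"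
    unfolding trunc_mgf_def
  proof (intro integral_mono integrable_trunc_mgf assms integrable_mult_right)
    fix \<omega>
    show "exp ((\<theta> + \<eta>) * W \<omega>) * indicator {-R..R} (W \<omega>)
        \<le> exp (\<bar>\<eta>\<bar> * R) * (exp (\<theta> * W \<omega>) * indicator {-R..R} (W \<omega>))"
      using exp_trunc_le[of "W \<omega>" R \<eta>] by (auto simp: indicator_def abs_le_iff distrib_right exp_add)
  qed
  then show ?thesis by (simp add: trunc_mgf_def)
qed

text \<open>Shifting the argument by \<open>\<eta>\<close> changes the integrand at most by the
  factor \<open>exp (\<bar>\<eta>\<bar> * R)\<close> in either direction, so the values are
  squeezed.\<close>

lemma continuous_trunc_mgf:
  assumes "W \<in> borel_measurable M"
  shows "isCont (trunc_mgf W R) \<theta>"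
  unfolding isCont_iff
proof (rule tendsto_sandwich)
  show "\<forall>\<^sub>F \<eta> in at 0. exp (- (\<bar>\<eta>\<bar> * R)) * trunc_mgf W R \<theta> \<le> trunc_mgf W R (\<theta> + \<eta>)"
  proof (rule always_eventually, rule allI)
    fix \<eta>
    have "exp (- (\<bar>\<eta>\<bar> * R)) * trunc_mgf W R \<theta> \<le> exp (- (\<bar>\<eta>\<bar> * R)) * (exp (\<bar>\<eta>\<bar> * R) * trunc_mgf W R (\<theta> + \<eta>))"
      using trunc_mgf_shift_le[OF assms, of R "\<theta> + \<eta>" "- \<eta>"] by (intro mult_left_mono) auto
    then show "exp (- (\<bar>\<eta>\<bar> * R)) * trunc_mgf W R \<theta> \<le> trunc_mgf W R (\<theta> + \<eta>)"
      by (simp add: mult.assoc[symmetric] mult_exp_exp)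
  qed
  show "\<forall>\<^sub>F \<eta> in at 0. trunc_mgf W R (\<theta> + \<eta>) \<le> exp (\<bar>\<eta>\<bar> * R) * trunc_mgf W R \<theta>"
    using trunc_mgf_shift_le[OF assms] by simp
  have "((\<lambda>\<eta>. exp (- (\<bar>\<eta>\<bar> * R)) * trunc_mgf W R \<theta>) \<longlongrightarrow> exp (- (\<bar>0\<bar> * R)) * trunc_mgf W R \<theta>) (at 0)"
    by (intro tendsto_intros)
  then show "((\<lambda>\<eta>. exp (- (\<bar>\<eta>\<bar> * R)) * trunc_mgf W R \<theta>) \<longlongrightarrow> trunc_mgf W R \<theta>) (at 0)" by simp
  have "((\<lambda>\<eta>. exp (\<bar>\<eta>\<bar> * R) * trunc_mgf W R \<theta>) \<longlongrightarrow> exp (\<bar>0\<bar> * R) * trunc_mgf W R \<theta>) (at 0)"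
    by (intro tendsto_intros)
  then show "((\<lambda>\<eta>. exp (\<bar>\<eta>\<bar> * R) * trunc_mgf W R \<theta>) \<longlongrightarrow> trunc_mgf W R \<theta>) (at 0)" by simp
qed

text \<open>The first-order term vanishes at a minimum. The second-order term is bounded by
  integrating \<open>exp x \<le> 1 + x + x\<^sup>2\<close>, which is available because the
  truncation keeps the exponent \<open>\<eta> * W\<close> within [-1, 1].\<close>

lemma trunc_mgf_near_minimum:
  assumes W: "W \<in> borel_measurable M" and "0 < R"
    and min: "\<And>\<theta>'. trunc_mgf W R \<theta> \<le> trunc_mgf W R \<theta>'"
    and \<eta>: "\<bar>\<eta>\<bar> * R \<le> 1"
  shows "trunc_mgf W R (\<theta> + \<eta>) \<le> (1 + \<eta>\<^sup>2 * R\<^sup>2) * trunc_mgf W R \<theta>"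
proof -
  define m where "m = trunc_mgf W R \<theta>"
  define d where "d = expectation (\<lambda>\<omega>. (W \<omega> * exp (\<theta> * W \<omega>)) * indicator {-R..R} (W \<omega>))"
  have m: "0 \<le> m" by (simp add: m_def trunc_mgf_nonneg)
  have int_d: "integrable M (\<lambda>\<omega>. (W \<omega> * exp (\<theta> * W \<omega>)) * indicator {-R..R} (W \<omega>))"
  proof (rule integrable_trunc[OF W, where B = "R * exp (\<bar>\<theta>\<bar> * R)" and g = "\<lambda>w. w * exp (\<theta> * w)"])
    show "\<bar>w * exp (\<theta> * w)\<bar> \<le> R * exp (\<bar>\<theta>\<bar> * R)" if "\<bar>w\<bar> \<le> R" for w
      using exp_trunc_le[OF that, of \<theta>] that by (simp add: abs_mult mult_mono)
  qed simp
  have quad: "trunc_mgf W R (\<theta> + h) \<le> (1 + h\<^sup>2 * R\<^sup>2) * m + h * d" if h: "\<bar>h\<bar> * R \<le> 1" for h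
  proof -
    have "trunc_mgf W R (\<theta> + h) \<le> expectation (\<lambda>\<omega>.
        (1 + h\<^sup>2 * R\<^sup>2) * (exp (\<theta> * W \<omega>) * indicator {-R..R} (W \<omega>))
        + h * ((W \<omega> * exp (\<theta> * W \<omega>)) * indicator {-R..R} (W \<omega>)))"
      unfolding trunc_mgf_def
    proof (intro integral_mono integrable_trunc_mgf W Bochner_Integration.integrable_add
        integrable_mult_right int_d)
      fix \<omega>
      let ?w = "W \<omega>"
      show "exp ((\<theta> + h) * ?w) * indicator {-R..R} ?w \<le>
          (1 + h\<^sup>2 * R\<^sup>2) * (exp (\<theta> * ?w) * indicator {-R..R} ?w)
          + h * ((?w * exp (\<theta> * ?w)) * indicator {-R..R} ?w)"
      proof (cases "?w \<in> {-R..R}")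
        case True
        then have w: "\<bar>?w\<bar> \<le> R" by auto
        then have "\<bar>h * ?w\<bar> \<le> \<bar>h\<bar> * R" by (simp add: abs_mult mult_left_mono)
        then have "exp (h * ?w) \<le> 1 + h * ?w + (h * ?w)\<^sup>2" using h by (intro exp_le_quadratic) simp
        also have "(h * ?w)\<^sup>2 \<le> h\<^sup>2 * R\<^sup>2"
          unfolding power_mult_distrib using w by (intro mult_left_mono) (auto simp: abs_le_square_iff[symmetric])
        finally have "exp (\<theta> * ?w) * exp (h * ?w) \<le> exp (\<theta> * ?w) * (1 + h * ?w + h\<^sup>2 * R\<^sup>2)"
          by (intro mult_left_mono) auto
        then show ?thesis using True by (simp add: distrib_right exp_add algebra_simps)
      qed simp
    qed
    also have "\<dots> = (1 + h\<^sup>2 * R\<^sup>2) * m + h * d"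
      unfolding m_def trunc_mgf_def d_def
      by (subst Bochner_Integration.integral_add) (auto intro!: integrable_trunc_mgf W integrable_mult_right int_d)
    finally show ?thesis .
  qed
  \<comment> \<open>\<open>d\<close> is the derivative at the minimum; a nonzero \<open>d\<close> is refuted by a small step against its sign.\<close>
  have "d = 0"
  proof (rule ccontr)
    assume "d \<noteq> 0"
    define Q where "Q = R\<^sup>2 * m + 1"
    \<comment> \<open>The first bound keeps the quadratic estimate valid; the second makes the
      quadratic gain at most half of the linear loss. The summand 1 in \<open>Q\<close> keeps the
      quotient meaningful if \<open>m = 0\<close>.\<close>
    define s where "s = min (1 / R) (\<bar>d\<bar> / (2 * Q))"
    have pos: "0 < Q" using m by (simp add: Q_def add_nonneg_pos)
    have s: "0 < s" "s \<le> 1 / R" using \<open>d \<noteq> 0\<close> pos \<open>0 < R\<close> by (auto simp: s_def)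
    define h where "h = - sgn d * s"
    have h: "\<bar>h\<bar> = s" "h * d = - (s * \<bar>d\<bar>)" "h\<^sup>2 = s\<^sup>2"
      using \<open>d \<noteq> 0\<close> s by (auto simp: h_def abs_mult sgn_if power2_eq_square)
    have "m \<le> (1 + h\<^sup>2 * R\<^sup>2) * m + h * d"
      using quad[of h] min[of "\<theta> + h"] h s \<open>0 < R\<close> by (simp add: m_def field_simps)
    then have "m \<le> (1 + s\<^sup>2 * R\<^sup>2) * m - s * \<bar>d\<bar>" unfolding h(2,3) by simp
    then have "s * \<bar>d\<bar> \<le> s * (s * (R\<^sup>2 * m))" by (simp add: algebra_simps power2_eq_square)
    then have "\<bar>d\<bar> \<le> s * (R\<^sup>2 * m)" using s by simp
    also have "\<dots> \<le> s * Q" using s by (simp add: Q_def)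
    also have "\<dots> \<le> \<bar>d\<bar> / (2 * Q) * Q"
      using pos by (intro mult_right_mono) (auto simp: s_def)
    also have "\<dots> = \<bar>d\<bar> / 2" using pos by simp
    finally show False using \<open>d \<noteq> 0\<close> by simp
  qed
  then show ?thesis using quad[OF \<eta>] by (simp add: m_def)
qed

lemma nn_integral_prod_iid:
  assumes indep: "indep_vars (\<lambda>_. borel) W {1..}"
    and distr: "\<And>i. 1 \<le> i \<Longrightarrow> distr M borel (W i) = distr M borel (W 1)"
    and [measurable]: "g \<in> borel_measurable borel"
  shows "(\<integral>\<^sup>+\<omega>. (\<Prod>i\<in>{1..k}. g (W i \<omega>)) \<partial>M) = (\<integral>\<^sup>+\<omega>. g (W 1 \<omega>) \<partial>M) ^ k"
proof -
  have W: "W i \<in> borel_measurable M" if "1 \<le> i" for i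
    using indep that by (auto simp: indep_vars_def)
  have "indep_vars (\<lambda>_. borel) (\<lambda>i \<omega>. g (W i \<omega>)) {1..k}"
    by (rule indep_vars_compose2[OF indep_vars_subset[OF indep]]) auto
  then have "(\<integral>\<^sup>+\<omega>. (\<Prod>i\<in>{1..k}. g (W i \<omega>)) \<partial>M) = (\<Prod>i\<in>{1..k}. \<integral>\<^sup>+\<omega>. g (W i \<omega>) \<partial>M)"
    by (intro indep_vars_nn_integral) auto
  also have "\<dots> = (\<Prod>i\<in>{1..k}. \<integral>\<^sup>+\<omega>. g (W 1 \<omega>) \<partial>M)"
  proof (rule prod.cong[OF refl])
    fix i assume "i \<in> {1..k}"
    then have i: "1 \<le> i" by simp
    have "(\<integral>\<^sup>+\<omega>. g (W i \<omega>) \<partial>M) = (\<integral>\<^sup>+w. g w \<partial>distr M borel (W i))"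
      by (rule nn_integral_distr[OF W[OF i], symmetric]) simp
    also have "\<dots> = (\<integral>\<^sup>+\<omega>. g (W 1 \<omega>) \<partial>M)"
      unfolding distr[OF i] by (intro nn_integral_distr W) auto
    finally show "(\<integral>\<^sup>+\<omega>. g (W i \<omega>) \<partial>M) = (\<integral>\<^sup>+\<omega>. g (W 1 \<omega>) \<partial>M)" .
  qed
  also have "\<dots> = (\<integral>\<^sup>+\<omega>. g (W 1 \<omega>) \<partial>M) ^ k" by simp
  finally show ?thesis .
qed

text \<open>Integrates a pointwise estimate, with S the sum. For
  \<open>\<bar>S\<bar> < k * \<delta>\<close> the weight \<open>exp (\<theta> * S)\<close> is at
  most \<open>exp (\<bar>\<theta>\<bar> * k * \<delta>)\<close>; beyond either end, moving
  \<open>\<theta>\<close> by \<open>\<eta>\<close> towards the sign of S gains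
  \<open>exp (- (\<eta> * k * \<delta>))\<close>. The truncation stays in both tail terms, so they
  remain finite.\<close>

lemma trunc_mgf_power_le:
  assumes indep: "indep_vars (\<lambda>_. borel) W {1..}"
    and distr: "\<And>i. 1 \<le> i \<Longrightarrow> distr M borel (W i) = distr M borel (W 1)"
    and pos: "0 \<le> \<delta>" "0 \<le> \<eta>"
  shows "trunc_mgf (W 1) R \<theta> ^ k
    \<le> exp (\<bar>\<theta>\<bar> * \<delta>) ^ k * prob {\<omega> \<in> space M. \<bar>\<Sum>i=1..k. W i \<omega>\<bar> < real k * \<delta>}
      + exp (- (\<eta> * \<delta>)) ^ k * (trunc_mgf (W 1) R (\<theta> + \<eta>) ^ k + trunc_mgf (W 1) R (\<theta> - \<eta>) ^ k)"
proof -
  define g where "g \<theta> w = exp (\<theta> * w) * indicator {-R..R} w" for \<theta> w :: real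
  define H where "H \<theta> \<omega> = (\<Prod>i\<in>{1..k}. g \<theta> (W i \<omega>))" for \<theta> \<omega>
  define S where "S \<omega> = (\<Sum>i=1..k. W i \<omega>)" for \<omega>
  have [measurable]: "W i \<in> borel_measurable M" if "1 \<le> i" for i
    using indep that by (auto simp: indep_vars_def)
  have [measurable]: "g \<theta> \<in> borel_measurable borel" for \<theta> unfolding g_def[abs_def] by measurable
  have [measurable]: "H \<theta> \<in> borel_measurable M" for \<theta>
    unfolding H_def[abs_def]
    by (intro borel_measurable_prod measurable_compose[of "W _" M borel "g _" borel]) auto
  have [measurable]: "S \<in> borel_measurable M"
    unfolding S_def[abs_def] by (intro borel_measurable_sum) auto
  have g0: "0 \<le> g \<theta> w" for \<theta> w by (simp add: g_def)
  have H0: "0 \<le> H \<theta> \<omega>" for \<theta> \<omega> by (simp add: H_def g0 prod_nonneg)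
  have H: "(\<integral>\<^sup>+\<omega>. ennreal (H \<theta> \<omega>) \<partial>M) = ennreal (trunc_mgf (W 1) R \<theta> ^ k)" for \<theta>
  proof -
    have "(\<integral>\<^sup>+\<omega>. ennreal (H \<theta> \<omega>) \<partial>M) = (\<integral>\<^sup>+\<omega>. (\<Prod>i\<in>{1..k}. ennreal (g \<theta> (W i \<omega>))) \<partial>M)"
      by (simp add: H_def prod_ennreal g0)
    also have "\<dots> = (\<integral>\<^sup>+\<omega>. ennreal (g \<theta> (W 1 \<omega>)) \<partial>M) ^ k"
      by (rule nn_integral_prod_iid[OF indep distr]) auto
    also have "\<dots> = ennreal (trunc_mgf (W 1) R \<theta> ^ k)"
      unfolding g_def by (simp add: nn_integral_trunc_mgf ennreal_power trunc_mgf_nonneg)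
    finally show ?thesis .
  qed
  have HS: "H \<theta> \<omega> = (if \<forall>i\<in>{1..k}. W i \<omega> \<in> {-R..R} then exp (\<theta> * S \<omega>) else 0)" for \<theta> \<omega>
  proof (cases "\<forall>i\<in>{1..k}. W i \<omega> \<in> {-R..R}")
    case True
    then have "H \<theta> \<omega> = (\<Prod>i\<in>{1..k}. exp (\<theta> * W i \<omega>))"
      unfolding H_def g_def by (intro prod.cong) auto
    also have "\<dots> = exp (\<theta> * S \<omega>)" by (simp add: S_def sum_distrib_left exp_sum)
    finally show ?thesis using True by simp
  next
    case False
    then obtain i where "i \<in> {1..k}" "g \<theta> (W i \<omega>) = 0" by (auto simp: g_def)
    then have "H \<theta> \<omega> = 0" unfolding H_def by (intro prod_zero) auto
    then show ?thesis using False by simp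
  qed
  define B where "B = {\<omega> \<in> space M. \<bar>S \<omega>\<bar> < real k * \<delta>}"
  have [measurable]: "B \<in> events" unfolding B_def by measurable
  define u where "u = exp (\<bar>\<theta>\<bar> * \<delta>) ^ k"
  define v where "v = exp (- (\<eta> * \<delta>)) ^ k"
  have uv: "0 \<le> u" "0 \<le> v" by (auto simp: u_def v_def)
  have u: "u = exp (\<bar>\<theta>\<bar> * (real k * \<delta>))"
    by (simp add: u_def exp_of_nat_mult[symmetric] algebra_simps)
  have v: "v = exp (- (\<eta> * (real k * \<delta>)))"
    by (simp add: v_def exp_of_nat_mult[symmetric] algebra_simps)
  have pt: "H \<theta> \<omega> \<le> u * indicator B \<omega> + v * (H (\<theta> + \<eta>) \<omega> + H (\<theta> - \<eta>) \<omega>)" if "\<omega> \<in> space M" for \<omega>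
  proof (cases "\<forall>i\<in>{1..k}. W i \<omega> \<in> {-R..R}")
    case True
    have Hs: "H \<theta> \<omega> = exp (\<theta> * S \<omega>)" for \<theta> using True by (simp add: HS)
    consider "\<bar>S \<omega>\<bar> < real k * \<delta>" | "real k * \<delta> \<le> S \<omega>" | "S \<omega> \<le> - (real k * \<delta>)" by linarith
    then show ?thesis
    proof cases
      case 1
      then have "H \<theta> \<omega> \<le> u * indicator B \<omega>"
        using that exp_trunc_le[of "S \<omega>" "real k * \<delta>" \<theta>] by (simp add: Hs u B_def)
      moreover have "0 \<le> v * (H (\<theta> + \<eta>) \<omega> + H (\<theta> - \<eta>) \<omega>)" using uv H0 by simp
      ultimately show ?thesis by linarith
    next
      case 2
      then have "\<eta> * (real k * \<delta>) \<le> \<eta> * S \<omega>" using pos by (intro mult_left_mono) auto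
      then have "H \<theta> \<omega> \<le> v * H (\<theta> + \<eta>) \<omega>" by (simp add: Hs v mult_exp_exp algebra_simps)
      moreover have "0 \<le> v * H (\<theta> - \<eta>) \<omega>" "0 \<le> u * indicator B \<omega>" using uv H0 by auto
      ultimately show ?thesis by (simp add: distrib_left)
    next
      case 3
      then have "\<eta> * S \<omega> \<le> \<eta> * (- (real k * \<delta>))" using pos by (intro mult_left_mono) auto
      then have "H \<theta> \<omega> \<le> v * H (\<theta> - \<eta>) \<omega>" by (simp add: Hs v mult_exp_exp algebra_simps)
      moreover have "0 \<le> v * H (\<theta> + \<eta>) \<omega>" "0 \<le> u * indicator B \<omega>" using uv H0 by auto
      ultimately show ?thesis by (simp add: distrib_left)
    qed
  next
    case False
    then have "H \<theta> \<omega> = 0" for \<theta> by (simp add: HS)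
    then show ?thesis using uv by simp
  qed
  have "ennreal (trunc_mgf (W 1) R \<theta> ^ k) = (\<integral>\<^sup>+\<omega>. ennreal (H \<theta> \<omega>) \<partial>M)" by (simp add: H)
  also have "\<dots> \<le> (\<integral>\<^sup>+\<omega>. ennreal u * indicator B \<omega> + ennreal v * (ennreal (H (\<theta> + \<eta>) \<omega>) + ennreal (H (\<theta> - \<eta>) \<omega>)) \<partial>M)"
  proof (rule nn_integral_mono)
    fix \<omega> assume "\<omega> \<in> space M"
    have "ennreal (H \<theta> \<omega>) \<le> ennreal (u * indicator B \<omega> + v * (H (\<theta> + \<eta>) \<omega> + H (\<theta> - \<eta>) \<omega>))"
      using pt[OF \<open>\<omega> \<in> space M\<close>] by (rule ennreal_leI)
    also have "\<dots> = ennreal u * indicator B \<omega> + ennreal v * (ennreal (H (\<theta> + \<eta>) \<omega>) + ennreal (H (\<theta> - \<eta>) \<omega>))"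
      using uv H0 by (simp add: ennreal_plus ennreal_mult ennreal_indicator)
    finally show "ennreal (H \<theta> \<omega>) \<le> \<dots>" .
  qed
  also have "\<dots> = ennreal u * emeasure M B + ennreal v * ((\<integral>\<^sup>+\<omega>. ennreal (H (\<theta> + \<eta>) \<omega>) \<partial>M) + (\<integral>\<^sup>+\<omega>. ennreal (H (\<theta> - \<eta>) \<omega>) \<partial>M))"
    by (simp add: nn_integral_add nn_integral_cmult)
  also have "\<dots> = ennreal (u * prob B + v * (trunc_mgf (W 1) R (\<theta> + \<eta>) ^ k + trunc_mgf (W 1) R (\<theta> - \<eta>) ^ k))"
    using uv by (simp add: H emeasure_eq_measure ennreal_plus ennreal_mult trunc_mgf_nonneg)
  finally have "trunc_mgf (W 1) R \<theta> ^ k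
      \<le> u * prob B + v * (trunc_mgf (W 1) R (\<theta> + \<eta>) ^ k + trunc_mgf (W 1) R (\<theta> - \<eta>) ^ k)"
    by (subst (asm) ennreal_le_iff) (use uv in \<open>simp_all add: trunc_mgf_nonneg\<close>)
  then show ?thesis by (simp only: u_def v_def B_def S_def)
qed

text \<open>If \<open>W\<close> has constant sign, the infimum of its generating function is the limit at \<open>\<plusminus>\<infinity>\<close>,
  which is \<open>P (W = 0)\<close>; a minimiser need not exist.\<close>

lemma cramer_lower_one_sided:
  fixes W :: "nat \<Rightarrow> 'a \<Rightarrow> real"
  assumes indep: "indep_vars (\<lambda>_. borel) W {1..}"
    and distr: "\<And>i. 1 \<le> i \<Longrightarrow> distr M borel (W i) = distr M borel (W 1)"
    and q: "0 \<le> q" "\<And>\<theta>. ennreal q \<le> (\<integral>\<^sup>+\<omega>. ennreal (exp (\<theta> * W 1 \<omega>)) \<partial>M)"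
    and s: "\<bar>s\<bar> = (1::real)" "AE \<omega> in M. 0 \<le> s * W 1 \<omega>"
  shows "q ^ k \<le> prob {\<omega> \<in> space M. \<forall>i\<in>{1..k}. W i \<omega> = 0}"
proof -
  have W[measurable]: "W i \<in> borel_measurable M" if "1 \<le> i" for i
    using indep that by (auto simp: indep_vars_def)
  define p where "p = prob {\<omega> \<in> space M. W 1 \<omega> = 0}"
  \<comment> \<open>Exponents run to infinity against the sign of \<open>W 1\<close>: the functions
    \<open>exp (- (m * \<bar>W 1\<bar>))\<close> decrease to the indicator of
    \<open>W 1 = 0\<close>.\<close>
  have "(\<lambda>m. expectation (\<lambda>\<omega>. exp (- (real m * \<bar>W 1 \<omega>\<bar>)))) \<longlonglongrightarrow> expectation (\<lambda>\<omega>. indicat_real {0} (W 1 \<omega>))"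
  proof (rule integral_dominated_convergence[where w = "\<lambda>_. 1"])
    show "AE \<omega> in M. (\<lambda>m. exp (- (real m * \<bar>W 1 \<omega>\<bar>))) \<longlonglongrightarrow> indicator {0} (W 1 \<omega>)"
    proof (rule AE_I2)
      fix \<omega>
      show "(\<lambda>m. exp (- (real m * \<bar>W 1 \<omega>\<bar>))) \<longlonglongrightarrow> indicator {0} (W 1 \<omega>)"
      proof (cases "W 1 \<omega> = 0")
        case False
        have "(\<lambda>m. exp (- \<bar>W 1 \<omega>\<bar>) ^ m) \<longlonglongrightarrow> 0"
          using False by (intro LIMSEQ_power_zero) simp
        then show ?thesis using False by (simp add: exp_of_nat_mult[symmetric])
      qed simp
    qed
  qed auto
  also have "expectation (\<lambda>\<omega>. indicat_real {0} (W 1 \<omega>)) = p"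
  proof -
    have "expectation (\<lambda>\<omega>. indicat_real {0} (W 1 \<omega>)) = expectation (indicat_real {\<omega> \<in> space M. W 1 \<omega> = 0})"
      by (intro Bochner_Integration.integral_cong) (auto simp: indicator_def)
    then show ?thesis by (simp add: p_def)
  qed
  finally have lim: "(\<lambda>m. expectation (\<lambda>\<omega>. exp (- (real m * \<bar>W 1 \<omega>\<bar>)))) \<longlonglongrightarrow> p" .
  have "q \<le> expectation (\<lambda>\<omega>. exp (- (real m * \<bar>W 1 \<omega>\<bar>)))" for m
  proof -
    have "ennreal q \<le> (\<integral>\<^sup>+\<omega>. ennreal (exp ((- real m * s) * W 1 \<omega>)) \<partial>M)" by (rule q)
    also have "\<dots> = (\<integral>\<^sup>+\<omega>. ennreal (exp (- (real m * \<bar>W 1 \<omega>\<bar>))) \<partial>M)"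
    proof (rule nn_integral_cong_AE)
      show "AE \<omega> in M. ennreal (exp ((- real m * s) * W 1 \<omega>)) = ennreal (exp (- (real m * \<bar>W 1 \<omega>\<bar>)))"
        using s(2)
      proof eventually_elim
        case (elim \<omega>)
        then have "\<bar>W 1 \<omega>\<bar> = s * W 1 \<omega>" using s(1) by (metis abs_mult abs_of_nonneg mult_1)
        then show ?case by simp
      qed
    qed
    also have "\<dots> = ennreal (expectation (\<lambda>\<omega>. exp (- (real m * \<bar>W 1 \<omega>\<bar>))))"
      by (intro nn_integral_eq_integral integrable_const_bound[where B = 1]) auto
    finally show ?thesis
      by (subst (asm) ennreal_le_iff) (auto intro: Bochner_Integration.integral_nonneg)
  qed
  then have "q \<le> p" by (intro LIMSEQ_le_const[OF lim]) auto
  \<comment> \<open>The probability that all \<open>k\<close> variables vanish is obtained as the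
    integral of a product of indicators.\<close>
  have "ennreal (p ^ k) = (\<integral>\<^sup>+\<omega>. indicator {0} (W 1 \<omega>) \<partial>M) ^ k"
  proof -
    have "(\<integral>\<^sup>+\<omega>. indicator {0} (W 1 \<omega>) \<partial>M) = (\<integral>\<^sup>+\<omega>. indicator {\<omega> \<in> space M. W 1 \<omega> = 0} \<omega> \<partial>M)"
      by (intro nn_integral_cong) (auto simp: indicator_def)
    then show ?thesis by (simp add: p_def emeasure_eq_measure ennreal_power)
  qed
  also have "\<dots> = (\<integral>\<^sup>+\<omega>. (\<Prod>i\<in>{1..k}. indicator {0} (W i \<omega>)) \<partial>M)"
    by (rule nn_integral_prod_iid[OF indep distr, symmetric]) auto
  also have "\<dots> = (\<integral>\<^sup>+\<omega>. indicator {\<omega> \<in> space M. \<forall>i\<in>{1..k}. W i \<omega> = 0} \<omega> \<partial>M)"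
  proof (rule nn_integral_cong)
    fix \<omega> assume "\<omega> \<in> space M"
    then show "(\<Prod>i\<in>{1..k}. indicator {0} (W i \<omega>)) = (indicator {\<omega> \<in> space M. \<forall>i\<in>{1..k}. W i \<omega> = 0} \<omega> :: ennreal)"
    proof (cases "\<forall>i\<in>{1..k}. W i \<omega> = 0")
      case False
      then obtain i where "i \<in> {1..k}" "W i \<omega> \<noteq> 0" by blast
      then have "(\<Prod>i\<in>{1..k}. indicator {0} (W i \<omega>)) = (0::ennreal)"
        by (intro prod_zero bexI[of _ i]) auto
      then show ?thesis using False by simp
    qed simp
  qed
  also have "\<dots> = ennreal (prob {\<omega> \<in> space M. \<forall>i\<in>{1..k}. W i \<omega> = 0})"
  proof -
    have "{\<omega> \<in> space M. \<forall>i\<in>{1..k}. W i \<omega> = 0} \<in> events"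
      by (intro sets.sets_Collect_finite_All) auto
    then show ?thesis by (simp add: emeasure_eq_measure)
  qed
  finally have "p ^ k \<le> prob {\<omega> \<in> space M. \<forall>i\<in>{1..k}. W i \<omega> = 0}"
    by (subst (asm) ennreal_inj) (auto simp: p_def)
  then show ?thesis using \<open>q \<le> p\<close> q(1) power_mono order_trans by blast
qed

text \<open>The bands from \<open>1 / (n + 1)\<close> to \<open>n\<close> exhaust the set where
  \<open>V\<close> is positive, so they cannot all be null. The lower end is fixed before
  \<open>N\<close>, so that one cutoff serves all truncation levels.\<close>

lemma prob_pos_imp_bounded_away:
  assumes [measurable]: "V \<in> borel_measurable M" and "\<not> (AE \<omega> in M. V \<omega> \<le> (0::real))"
  shows "\<exists>n::nat. \<forall>N\<ge>n. 0 < prob {\<omega> \<in> space M. 1 / real (Suc n) \<le> V \<omega> \<and> V \<omega> \<le> real N}"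
proof (rule ccontr)
  assume *: "\<not> ?thesis"
  have zero: "prob {\<omega> \<in> space M. 1 / real (Suc n) \<le> V \<omega> \<and> V \<omega> \<le> real n} = 0" for n
  proof (rule ccontr)
    assume "prob {\<omega> \<in> space M. 1 / real (Suc n) \<le> V \<omega> \<and> V \<omega> \<le> real n} \<noteq> 0"
    then have pos: "0 < prob {\<omega> \<in> space M. 1 / real (Suc n) \<le> V \<omega> \<and> V \<omega> \<le> real n}"
      using measure_nonneg by (metis less_eq_real_def)
    have "0 < prob {\<omega> \<in> space M. 1 / real (Suc n) \<le> V \<omega> \<and> V \<omega> \<le> real N}" if "n \<le> N" for N
      using that by (intro less_le_trans[OF pos] finite_measure_mono) auto
    then show False using * by blast
  qed
  have "AE \<omega> in M. \<forall>n::nat. \<not> (1 / real (Suc n) \<le> V \<omega> \<and> V \<omega> \<le> real n)"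
    unfolding AE_all_countable
  proof
    fix n :: nat
    show "AE \<omega> in M. \<not> (1 / real (Suc n) \<le> V \<omega> \<and> V \<omega> \<le> real n)"
      using zero[of n] by (intro AE_I[of _ _ "{\<omega> \<in> space M. 1 / real (Suc n) \<le> V \<omega> \<and> V \<omega> \<le> real n}"])
        (auto simp: emeasure_eq_measure)
  qed
  then have "AE \<omega> in M. V \<omega> \<le> 0"
  proof eventually_elim
    case (elim \<omega>)
    show ?case
    proof (rule ccontr)
      assume "\<not> V \<omega> \<le> 0"
      then have V: "0 < V \<omega>" by simp
      obtain n1 where n1: "V \<omega> < real n1" using reals_Archimedean2 by blast
      obtain n2 where n2: "1 / real (Suc n2) < V \<omega>"
        using reals_Archimedean[OF V] by (auto simp: inverse_eq_divide)
      have "1 / real (Suc (max n1 n2)) \<le> 1 / real (Suc n2)" by (intro divide_left_mono) auto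
      with elim[rule_format, of "max n1 n2"] n1 n2 show False by auto
    qed
  qed
  then show False using assms(2) by blast
qed

text \<open>Keeps only the mass in the band from \<open>\<epsilon>\<close> to \<open>R\<close>. With
  positive mass and \<open>\<epsilon> > 0\<close> this forces growth as \<open>\<theta>\<close>
  tends to infinity; applied to \<open>-W\<close> it controls the other end.\<close>

lemma trunc_mgf_coercive:
  assumes [measurable]: "W \<in> borel_measurable M" and R: "0 \<le> \<epsilon>" and \<theta>: "0 \<le> \<theta>"
  shows "prob {\<omega> \<in> space M. \<epsilon> \<le> W \<omega> \<and> W \<omega> \<le> R} * exp (\<theta> * \<epsilon>) \<le> trunc_mgf W R \<theta>"
proof -
  let ?A = "{\<omega> \<in> space M. \<epsilon> \<le> W \<omega> \<and> W \<omega> \<le> R}"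
  have "prob ?A * exp (\<theta> * \<epsilon>) = expectation (\<lambda>\<omega>. exp (\<theta> * \<epsilon>) * indicator ?A \<omega>)" by simp
  also have "\<dots> \<le> trunc_mgf W R \<theta>"
    unfolding trunc_mgf_def
  proof (intro integral_mono integrable_trunc_mgf assms)
    have "?A \<in> events" by measurable
    then show "integrable M (\<lambda>\<omega>. exp (\<theta> * \<epsilon>) * indicator ?A \<omega>)"
      by (intro integrable_mult_right integrable_real_indicator) (simp_all add: emeasure_eq_measure)
    fix \<omega>
    show "exp (\<theta> * \<epsilon>) * indicator ?A \<omega> \<le> exp (\<theta> * W \<omega>) * indicator {-R..R} (W \<omega>)"
      using R \<theta> by (auto simp: indicator_def mult_left_mono)
  qed
  finally show ?thesis .
qed

lemma trunc_mgf_uminus: "trunc_mgf (\<lambda>\<omega>. - W \<omega>) R (- \<theta>) = trunc_mgf W R \<theta>"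
  unfolding trunc_mgf_def by (intro Bochner_Integration.integral_cong) (auto simp: indicator_def)

lemma trunc_mgf_mono:
  assumes "W \<in> borel_measurable M" "R \<le> R'"
  shows "trunc_mgf W R \<theta> \<le> trunc_mgf W R' \<theta>"
  unfolding trunc_mgf_def using assms
  by (intro integral_mono integrable_trunc_mgf) (auto simp: indicator_def)

text \<open>Mass on both sides of 0 makes the truncated function coercive, so a minimiser exists.
  Truncation lowers the function, and the point is that one radius keeps it above \<open>q'\<close>
  for all arguments simultaneously.\<close>

lemma ex_trunc_mgf_gt:
  fixes W :: "'a \<Rightarrow> real"
  assumes W[measurable]: "W \<in> borel_measurable M"
    and q: "0 < q'" "q' < q" "\<And>\<theta>. ennreal q \<le> (\<integral>\<^sup>+\<omega>. ennreal (exp (\<theta> * W \<omega>)) \<partial>M)"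
    and pos: "\<not> (AE \<omega> in M. W \<omega> \<le> 0)" and neg: "\<not> (AE \<omega> in M. - W \<omega> \<le> 0)"
  shows "\<exists>R \<theta>. 0 < R \<and> q' < trunc_mgf W R \<theta> \<and> (\<forall>\<theta>'. trunc_mgf W R \<theta> \<le> trunc_mgf W R \<theta>')"
proof -
  obtain n1 where n1: "\<And>N. n1 \<le> N \<Longrightarrow> 0 < prob {\<omega> \<in> space M. 1 / real (Suc n1) \<le> W \<omega> \<and> W \<omega> \<le> real N}"
    using prob_pos_imp_bounded_away[OF W pos] by blast
  obtain n2 where n2: "\<And>N. n2 \<le> N \<Longrightarrow> 0 < prob {\<omega> \<in> space M. 1 / real (Suc n2) \<le> - W \<omega> \<and> - W \<omega> \<le> real N}"
    using prob_pos_imp_bounded_away[of "\<lambda>\<omega>. - W \<omega>", OF _ neg] by auto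
  \<comment> \<open>Large enough for both cutoffs; the successor makes the radius positive.\<close>
  define N0 where "N0 = Suc (max n1 n2)"
  have coercive: "\<exists>B\<ge>0. \<forall>\<theta>. B < \<bar>\<theta>\<bar> \<longrightarrow> c < trunc_mgf W (real N) \<theta>" if "N0 \<le> N" for N and c :: real
  proof -
    define p1 where "p1 = prob {\<omega> \<in> space M. 1 / real (Suc n1) \<le> W \<omega> \<and> W \<omega> \<le> real N}"
    define p2 where "p2 = prob {\<omega> \<in> space M. 1 / real (Suc n2) \<le> - W \<omega> \<and> - W \<omega> \<le> real N}"
    have p: "0 < p1" "0 < p2" unfolding p1_def p2_def using that by (intro n1 n2; simp add: N0_def)+
    have ex: "\<exists>B\<ge>0. \<forall>\<theta>>B. c < p * exp (\<theta> * e)" if "0 < p" "0 < e" for p e :: real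
    proof -
      have "filterlim (\<lambda>\<theta>. p * exp (\<theta> * e)) at_top at_top"
        using that by (intro filterlim_tendsto_pos_mult_at_top[OF tendsto_const]
            filterlim_compose[OF exp_at_top] filterlim_at_top_mult_tendsto_pos[OF tendsto_const] filterlim_ident) auto
      then have "\<forall>\<^sub>F \<theta> in at_top. c < p * exp (\<theta> * e)" by (simp add: filterlim_at_top_dense)
      then obtain b where "\<forall>\<theta>\<ge>b. c < p * exp (\<theta> * e)" by (auto simp: eventually_at_top_linorder)
      then show ?thesis by (intro exI[of _ "max b 0"]) auto
    qed
    obtain B1 where B1: "0 \<le> B1" "\<And>\<theta>. B1 < \<theta> \<Longrightarrow> c < p1 * exp (\<theta> * (1 / real (Suc n1)))"
      using ex[OF p(1), of "1 / real (Suc n1)"] by auto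
    obtain B2 where B2: "0 \<le> B2" "\<And>\<theta>. B2 < \<theta> \<Longrightarrow> c < p2 * exp (\<theta> * (1 / real (Suc n2)))"
      using ex[OF p(2), of "1 / real (Suc n2)"] by auto
    have "c < trunc_mgf W (real N) \<theta>" if "max B1 B2 < \<bar>\<theta>\<bar>" for \<theta>
    proof (cases "0 \<le> \<theta>")
      case True
      then have "c < p1 * exp (\<theta> * (1 / real (Suc n1)))" using that by (intro B1) auto
      also have "\<dots> \<le> trunc_mgf W (real N) \<theta>"
        unfolding p1_def using True by (intro trunc_mgf_coercive) auto
      finally show ?thesis .
    next
      case False
      then have "c < p2 * exp (- \<theta> * (1 / real (Suc n2)))" using that by (intro B2) auto
      also have "\<dots> \<le> trunc_mgf (\<lambda>\<omega>. - W \<omega>) (real N) (- \<theta>)"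
        unfolding p2_def using False by (intro trunc_mgf_coercive) auto
      finally show ?thesis by (simp add: trunc_mgf_uminus)
    qed
    then show ?thesis using B1(1) by (intro exI[of _ "max B1 B2"]) auto
  qed
  have cont: "continuous_on S (trunc_mgf W R)" for S R
    by (intro continuous_at_imp_continuous_on ballI continuous_trunc_mgf W)
  \<comment> \<open>Otherwise the compact sublevel sets \<open>C n\<close> are nonempty and nested, and at a common point monotone
    convergence violates the bound \<open>q\<close> on the untruncated generating function.\<close>
  have "\<exists>N\<ge>N0. \<forall>\<theta>. q' < trunc_mgf W (real N) \<theta>"
  proof (rule ccontr)
    assume contra: "\<not> ?thesis"
    define C where "C n = {\<theta>. trunc_mgf W (real (N0 + n)) \<theta> \<le> q'}" for n
    have "\<Inter>(range C) \<noteq> {}"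
    proof (rule compact_nest)
      fix n
      obtain B where B: "\<And>\<theta>. B < \<bar>\<theta>\<bar> \<Longrightarrow> q' < trunc_mgf W (real (N0 + n)) \<theta>"
        using coercive[of "N0 + n" q'] by auto
      have "C n \<subseteq> cball 0 B"
      proof
        fix \<theta> assume "\<theta> \<in> C n"
        then show "\<theta> \<in> cball 0 B" using B[of \<theta>] by (cases "B < \<bar>\<theta>\<bar>") (auto simp: C_def)
      qed
      moreover have "closed (C n)" unfolding C_def
        by (intro closed_Collect_le cont continuous_on_const)
      ultimately show "compact (C n)"
        by (meson bounded_cball bounded_subset compact_eq_bounded_closed)
      have "\<not> (\<forall>\<theta>. q' < trunc_mgf W (real (N0 + n)) \<theta>)" using contra le_add1 by blast
      then show "C n \<noteq> {}" by (auto simp: C_def not_less)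
    next
      fix m n :: nat assume "m \<le> n"
      then have "trunc_mgf W (real (N0 + m)) \<theta> \<le> trunc_mgf W (real (N0 + n)) \<theta>" for \<theta>
        by (intro trunc_mgf_mono W) simp
      then show "C n \<subseteq> C m" by (auto simp: C_def intro: order_trans)
    qed
    then obtain \<theta> where \<theta>: "\<And>n. trunc_mgf W (real (N0 + n)) \<theta> \<le> q'" by (auto simp: C_def)
    define f where "f n \<omega> = ennreal (exp (\<theta> * W \<omega>) * indicator {-real (N0 + n)..real (N0 + n)} (W \<omega>))" for n \<omega>
    have "ennreal q \<le> (\<integral>\<^sup>+\<omega>. ennreal (exp (\<theta> * W \<omega>)) \<partial>M)" by (rule q)
    also have "\<dots> \<le> (\<integral>\<^sup>+\<omega>. (SUP n. f n \<omega>) \<partial>M)"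
    proof (rule nn_integral_mono)
      fix \<omega>
      obtain n where "\<bar>W \<omega>\<bar> \<le> real n" using real_arch_simple by blast
      then have "f n \<omega> = ennreal (exp (\<theta> * W \<omega>))" by (auto simp: f_def indicator_def)
      then show "ennreal (exp (\<theta> * W \<omega>)) \<le> (SUP n. f n \<omega>)" by (metis SUP_upper UNIV_I)
    qed
    also have "\<dots> = (SUP n. \<integral>\<^sup>+\<omega>. f n \<omega> \<partial>M)"
    proof (rule nn_integral_monotone_convergence_SUP)
      show "incseq f"
        by (intro incseq_SucI le_funI) (auto simp: f_def indicator_def intro!: ennreal_leI)
      show "f n \<in> borel_measurable M" for n unfolding f_def[abs_def] by measurable
    qed
    also have "\<dots> \<le> ennreal q'"
    proof (rule SUP_least)
      fix n
      show "(\<integral>\<^sup>+\<omega>. f n \<omega> \<partial>M) \<le> ennreal q'"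
        unfolding f_def nn_integral_trunc_mgf[OF W] using \<theta> by (rule ennreal_leI)
    qed
    finally show False using q by simp
  qed
  then obtain N where N: "N0 \<le> N" "\<And>\<theta>. q' < trunc_mgf W (real N) \<theta>" by blast
  \<comment> \<open>Outside \<open>cball 0 B\<close> the function exceeds its value at 0, so a
    minimum over this ball is global.\<close>
  obtain B where B: "0 \<le> B" "\<And>\<theta>. B < \<bar>\<theta>\<bar> \<Longrightarrow> trunc_mgf W (real N) 0 < trunc_mgf W (real N) \<theta>"
    using coercive[OF N(1), of "trunc_mgf W (real N) 0"] by auto
  have "\<exists>\<theta>\<in>cball 0 B. \<forall>\<theta>'\<in>cball 0 B. trunc_mgf W (real N) \<theta> \<le> trunc_mgf W (real N) \<theta>'"
    using B(1) by (intro continuous_attains_inf cont) auto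
  then obtain \<theta> where \<theta>: "\<And>\<theta>'. \<theta>' \<in> cball 0 B \<Longrightarrow> trunc_mgf W (real N) \<theta> \<le> trunc_mgf W (real N) \<theta>'"
    by blast
  have "trunc_mgf W (real N) \<theta> \<le> trunc_mgf W (real N) \<theta>'" for \<theta>'
  proof (cases "\<theta>' \<in> cball 0 B")
    case False
    then have "trunc_mgf W (real N) 0 < trunc_mgf W (real N) \<theta>'" by (intro B) auto
    then show ?thesis using \<theta>[of 0] B(1) by simp
  qed (rule \<theta>)
  moreover have "0 < real N" using N(1) by (simp add: N0_def)
  ultimately show ?thesis using N(2) by blast
qed

text \<open>Here \<open>q\<close> bounds the generating function of \<open>W 1\<close> from below at
  every argument. The margin between \<open>q\<close> and \<open>q'\<close> is spent twice: on
  truncation, and on the factor \<open>exp (\<bar>\<theta>\<bar> * d)\<close> within the window. The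
  window may be shrunk to \<open>d\<close>, since this only lowers the probability.\<close>

lemma cramer_lower:
  fixes W :: "nat \<Rightarrow> 'a \<Rightarrow> real"
  assumes indep: "indep_vars (\<lambda>_. borel) W {1..}"
    and distr: "\<And>i. 1 \<le> i \<Longrightarrow> distr M borel (W i) = distr M borel (W 1)"
    and q: "0 < q'" "q' < q" "\<And>\<theta>. ennreal q \<le> (\<integral>\<^sup>+\<omega>. ennreal (exp (\<theta> * W 1 \<omega>)) \<partial>M)"
    and "0 < \<delta>"
  shows "\<forall>\<^sub>F k in sequentially. q' ^ k \<le> prob {\<omega> \<in> space M. \<bar>\<Sum>i=1..k. W i \<omega>\<bar> < real k * \<delta>}"
proof -
  have W[measurable]: "W i \<in> borel_measurable M" if "1 \<le> i" for i
    using indep that by (auto simp: indep_vars_def)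
  have S[measurable]: "(\<lambda>\<omega>. \<Sum>i=1..k. W i \<omega>) \<in> borel_measurable M" for k
    by (intro borel_measurable_sum) auto
  have ev: "{\<omega> \<in> space M. \<bar>\<Sum>i=1..k. W i \<omega>\<bar> < real k * \<delta>} \<in> events" for k
    by measurable
  show ?thesis
  proof (cases "(AE \<omega> in M. W 1 \<omega> \<le> 0) \<or> (AE \<omega> in M. - W 1 \<omega> \<le> 0)")
    case True
    have *: "q ^ k \<le> prob {\<omega> \<in> space M. \<forall>i\<in>{1..k}. W i \<omega> = 0}" for k
      using True
    proof
      assume "AE \<omega> in M. W 1 \<omega> \<le> 0"
      then show ?thesis
        using q by (intro cramer_lower_one_sided[OF indep distr, of q "-1"]) auto
    next
      assume "AE \<omega> in M. - W 1 \<omega> \<le> 0"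
      then show ?thesis
        using q by (intro cramer_lower_one_sided[OF indep distr, of q 1]) auto
    qed
    show ?thesis
      using eventually_gt_at_top[of 0]
    proof eventually_elim
      case (elim k)
      have "q' ^ k \<le> q ^ k" using q by (intro power_mono) auto
      also have "\<dots> \<le> prob {\<omega> \<in> space M. \<forall>i\<in>{1..k}. W i \<omega> = 0}" by (rule *)
      also have "\<dots> \<le> prob {\<omega> \<in> space M. \<bar>\<Sum>i=1..k. W i \<omega>\<bar> < real k * \<delta>}"
        using elim \<open>0 < \<delta>\<close> by (intro finite_measure_mono ev) auto
      finally show ?case .
    qed
  next
    case False
    then obtain R \<theta> where R: "0 < R" and gt: "q' < trunc_mgf (W 1) R \<theta>"
      and min: "\<And>\<theta>'. trunc_mgf (W 1) R \<theta> \<le> trunc_mgf (W 1) R \<theta>'"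
      using ex_trunc_mgf_gt[OF W[of 1] q] by auto
    define m where "m = trunc_mgf (W 1) R \<theta>"
    have m: "0 < m" "q' < m" using gt q by (auto simp: m_def)
    \<comment> \<open>Chosen so that \<open>q' * exp (\<bar>\<theta>\<bar> * d) < m\<close>; the
      summand 1 makes the inequality strict and allows \<open>\<theta> = 0\<close>.\<close>
    define d where "d = min \<delta> (ln (m / q') / (\<bar>\<theta>\<bar> + 1))"
    have L: "0 < ln (m / q')" using m q by simp
    have d: "0 < d" "d \<le> \<delta>" using L \<open>0 < \<delta>\<close> by (auto simp: d_def add_nonneg_pos)
    have "(\<bar>\<theta>\<bar> + 1) * d \<le> (\<bar>\<theta>\<bar> + 1) * (ln (m / q') / (\<bar>\<theta>\<bar> + 1))"
      by (intro mult_left_mono) (auto simp: d_def)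
    also have "\<dots> = ln (m / q')" by (simp add: add_nonneg_pos[THEN less_imp_neq, symmetric])
    finally have "(\<bar>\<theta>\<bar> + 1) * d \<le> ln (m / q')" .
    then have "\<bar>\<theta>\<bar> * d < ln (m / q')" using d by (simp add: distrib_right)
    then have "exp (\<bar>\<theta>\<bar> * d) < exp (ln (m / q'))" by (simp only: exp_less_cancel_iff)
    then have x: "q' * exp (\<bar>\<theta>\<bar> * d) < m" using m q by (simp add: field_simps)
    \<comment> \<open>The linear gain \<open>\<eta> * d\<close> has to beat the quadratic loss from
      leaving the minimum, hence \<open>\<eta> * R\<^sup>2 < d\<close>; the bound
      \<open>1 / R\<close> is needed for \<open>trunc_mgf_near_minimum\<close>.\<close>
    define \<eta> where "\<eta> = min (1 / R) (d / (2 * R\<^sup>2))"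
    have \<eta>: "0 < \<eta>" "\<bar>\<eta>\<bar> * R \<le> 1" "\<eta> * R\<^sup>2 < d"
      using R d by (auto simp: \<eta>_def min_def field_simps power2_eq_square)
    \<comment> \<open>The ratio per summand: the two tails together take at most
      \<open>2 * c ^ k\<close> of the total \<open>m ^ k\<close>.\<close>
    define c where "c = (1 + \<eta>\<^sup>2 * R\<^sup>2) * exp (- (\<eta> * d))"
    have c: "0 \<le> c" "c < 1"
    proof -
      have "c \<le> exp (\<eta>\<^sup>2 * R\<^sup>2) * exp (- (\<eta> * d))"
        unfolding c_def using exp_ge_add_one_self[of "\<eta>\<^sup>2 * R\<^sup>2"] by (intro mult_right_mono) auto
      also have "\<dots> = exp (\<eta> * (\<eta> * R\<^sup>2 - d))"
        by (simp add: mult_exp_exp algebra_simps power2_eq_square)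
      also have "\<dots> < 1" using \<eta> by (simp add: mult_pos_neg)
      finally show "c < 1" .
    qed (simp add: c_def)
    define P where "P k = prob {\<omega> \<in> space M. \<bar>\<Sum>i=1..k. W i \<omega>\<bar> < real k * d}" for k
    have lower: "m ^ k * (1 - 2 * c ^ k) \<le> exp (\<bar>\<theta>\<bar> * d) ^ k * P k" for k
    proof -
      have b: "trunc_mgf (W 1) R (\<theta> + h) ^ k \<le> ((1 + \<eta>\<^sup>2 * R\<^sup>2) * m) ^ k" if "h = \<eta> \<or> h = - \<eta>" for h
        using trunc_mgf_near_minimum[OF W[of 1] R min, of h] that \<eta>
        by (intro power_mono trunc_mgf_nonneg) (auto simp: m_def)
      have "m ^ k \<le> exp (\<bar>\<theta>\<bar> * d) ^ k * P k
          + exp (- (\<eta> * d)) ^ k * (trunc_mgf (W 1) R (\<theta> + \<eta>) ^ k + trunc_mgf (W 1) R (\<theta> - \<eta>) ^ k)"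
        unfolding m_def P_def using d \<eta> by (intro trunc_mgf_power_le[OF indep distr]) auto
      also have "\<dots> \<le> exp (\<bar>\<theta>\<bar> * d) ^ k * P k
          + exp (- (\<eta> * d)) ^ k * (((1 + \<eta>\<^sup>2 * R\<^sup>2) * m) ^ k + ((1 + \<eta>\<^sup>2 * R\<^sup>2) * m) ^ k)"
        using b[of \<eta>] b[of "- \<eta>"] by (intro add_left_mono mult_left_mono add_mono) auto
      also have "\<dots> = exp (\<bar>\<theta>\<bar> * d) ^ k * P k + 2 * (m ^ k * c ^ k)"
        by (simp add: c_def power_mult_distrib)
      finally show ?thesis by (simp add: algebra_simps)
    qed
    \<comment> \<open>Once \<open>z ^ k + 2 * c ^ k < 1\<close>, what the tails leave of
      \<open>m ^ k\<close> exceeds \<open>(q' * exp (\<bar>\<theta>\<bar> * d)) ^ k\<close>.\<close>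
    define z where "z = q' * exp (\<bar>\<theta>\<bar> * d) / m"
    have z: "0 \<le> z" "z < 1" using x m q by (auto simp: z_def)
    have "(\<lambda>k. z ^ k + 2 * c ^ k) \<longlonglongrightarrow> 0 + 2 * 0"
      using z c by (intro tendsto_intros LIMSEQ_power_zero) auto
    then have "\<forall>\<^sub>F k in sequentially. z ^ k + 2 * c ^ k < 1"
      by (rule order_tendstoD) simp
    then show ?thesis
    proof eventually_elim
      case (elim k)
      have "(q' * exp (\<bar>\<theta>\<bar> * d)) ^ k = m ^ k * z ^ k"
        using m by (simp add: z_def power_divide)
      also have "\<dots> \<le> m ^ k * (1 - 2 * c ^ k)" using elim m by (intro mult_left_mono) auto
      also have "\<dots> \<le> exp (\<bar>\<theta>\<bar> * d) ^ k * P k" by (rule lower)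
      finally have "exp (\<bar>\<theta>\<bar> * d) ^ k * q' ^ k \<le> exp (\<bar>\<theta>\<bar> * d) ^ k * P k"
        by (simp add: power_mult_distrib mult.commute)
      then have "q' ^ k \<le> P k" by (subst (asm) mult_le_cancel_left_pos) auto
      also have "P k \<le> prob {\<omega> \<in> space M. \<bar>\<Sum>i=1..k. W i \<omega>\<bar> < real k * \<delta>}"
        unfolding P_def
      proof (intro finite_measure_mono ev Collect_mono impI)
        fix \<omega> assume "\<omega> \<in> space M \<and> \<bar>\<Sum>i=1..k. W i \<omega>\<bar> < real k * d"
        moreover have "real k * d \<le> real k * \<delta>" using d by (intro mult_left_mono) auto
        ultimately show "\<omega> \<in> space M \<and> \<bar>\<Sum>i=1..k. W i \<omega>\<bar> < real k * \<delta>" by linarith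
      qed
      finally show ?case .
    qed
  qed
qed

section \<open>From centred sums to \<open>S_proc\<close>\<close>

lemma indep_vars_shift:
  fixes X :: "nat \<Rightarrow> 'a \<Rightarrow> real"
  assumes "indep_vars (\<lambda>_. borel) X I"
  shows "indep_vars (\<lambda>_. borel) (\<lambda>i \<omega>. X i \<omega> - y) I"
  by (rule indep_vars_compose2[OF assms]) auto

lemma distr_shift_cong:
  fixes X Y :: "'a \<Rightarrow> real"
  assumes "X \<in> borel_measurable M" "Y \<in> borel_measurable M" "distr M borel X = distr M borel Y"
  shows "distr M borel (\<lambda>\<omega>. X \<omega> - y) = distr M borel (\<lambda>\<omega>. Y \<omega> - y)"
proof -
  have "distr M borel (\<lambda>\<omega>. X \<omega> - y) = distr (distr M borel X) borel (\<lambda>x. x - y)"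
    using assms by (subst distr_distr) (auto simp: comp_def)
  also have "\<dots> = distr M borel (\<lambda>\<omega>. Y \<omega> - y)"
    unfolding assms(3) using assms by (subst distr_distr) (auto simp: comp_def)
  finally show ?thesis .
qed

text \<open>With \<open>\<theta>\<close> inside the event, one statement covers both tails: the sign
  of \<open>\<theta>\<close> selects the tail.\<close>

lemma prob_sum_chernoff:
  fixes X :: "nat \<Rightarrow> 'a \<Rightarrow> real"
  assumes indep: "indep_vars (\<lambda>_. borel) X {1..}"
    and distr: "\<And>i. 1 \<le> i \<Longrightarrow> distr M borel (X i) = distr M borel (X 1)"
    and a: "0 \<le> a" "(\<integral>\<^sup>+\<omega>. ennreal (exp (\<theta> * X 1 \<omega>)) \<partial>M) = ennreal a"
  shows "prob {\<omega> \<in> space M. s < \<theta> * (\<Sum>i=1..k. X i \<omega>)} \<le> exp (- s) * a ^ k"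
proof -
  have [measurable]: "X i \<in> borel_measurable M" if "1 \<le> i" for i
    using indep that by (auto simp: indep_vars_def)
  have [measurable]: "(\<lambda>\<omega>. \<Sum>i=1..k. X i \<omega>) \<in> borel_measurable M"
    by (intro borel_measurable_sum) auto
  have "(\<lambda>\<omega>. \<Prod>i\<in>{1..k}. ennreal (exp (\<theta> * X i \<omega>))) \<in> borel_measurable M"
    by (intro borel_measurable_prod_ennreal) auto
  note [measurable] = this
  let ?A = "{\<omega> \<in> space M. s < \<theta> * (\<Sum>i=1..k. X i \<omega>)}"
  have A: "?A \<in> events" by measurable
  have "emeasure M ?A = (\<integral>\<^sup>+\<omega>. indicator ?A \<omega> \<partial>M)" using A by simp
  also have "\<dots> \<le> (\<integral>\<^sup>+\<omega>. ennreal (exp (- s)) * (\<Prod>i\<in>{1..k}. ennreal (exp (\<theta> * X i \<omega>))) \<partial>M)"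
  proof (rule nn_integral_mono)
    fix \<omega>
    have "(\<Prod>i\<in>{1..k}. ennreal (exp (\<theta> * X i \<omega>))) = ennreal (exp (\<theta> * (\<Sum>i=1..k. X i \<omega>)))"
      by (simp add: prod_ennreal sum_distrib_left exp_sum)
    then have "ennreal (exp (- s)) * (\<Prod>i\<in>{1..k}. ennreal (exp (\<theta> * X i \<omega>)))
        = ennreal (exp (\<theta> * (\<Sum>i=1..k. X i \<omega>) - s))"
      by (simp add: ennreal_mult[symmetric] mult_exp_exp)
    moreover have "1 \<le> exp (\<theta> * (\<Sum>i=1..k. X i \<omega>) - s)" if "\<omega> \<in> ?A" using that by simp
    ultimately show "indicator ?A \<omega> \<le> ennreal (exp (- s)) * (\<Prod>i\<in>{1..k}. ennreal (exp (\<theta> * X i \<omega>)))"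
      by (auto simp: indicator_def simp flip: ennreal_1 intro!: ennreal_leI)
  qed
  also have "\<dots> = ennreal (exp (- s)) * (\<integral>\<^sup>+\<omega>. (\<Prod>i\<in>{1..k}. ennreal (exp (\<theta> * X i \<omega>))) \<partial>M)"
    by (rule nn_integral_cmult) measurable
  also have "(\<integral>\<^sup>+\<omega>. (\<Prod>i\<in>{1..k}. ennreal (exp (\<theta> * X i \<omega>))) \<partial>M)
      = (\<integral>\<^sup>+\<omega>. ennreal (exp (\<theta> * X 1 \<omega>)) \<partial>M) ^ k"
    by (rule nn_integral_prod_iid[OF indep distr, where g = "\<lambda>x. ennreal (exp (\<theta> * x))"]) auto
  also have "ennreal (exp (- s)) * \<dots> = ennreal (exp (- s) * a ^ k)"
    unfolding a(2) using a(1) by (simp add: ennreal_power ennreal_mult)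
  finally show ?thesis using a(1) by (simp add: emeasure_eq_measure)
qed

text \<open>A single nearly optimal \<open>\<theta>\<close> gives the local upper bound, on an open
  half-line containing the point. For the lower bound, \<open>Lambda_star\<close> being below
  \<open>s\<close> at \<open>x\<close> says precisely that the generating function of
  \<open>\<nu> 1 - x / t\<close> stays above \<open>exp (- (s / t))\<close> at every argument, which
  is what \<open>cramer_lower\<close> asks for.\<close>

lemma local_LDP_S_proc:
  fixes \<nu> :: "nat \<Rightarrow> 'a \<Rightarrow> real"
  assumes t: "0 < t"
    and indep: "indep_vars (\<lambda>_. borel) \<nu> {1..}"
    and distr: "\<And>i. 1 \<le> i \<Longrightarrow> distr M borel (\<nu> i) = distr M borel (\<nu> 1)"
    and nonneg: "\<And>i \<omega>. 1 \<le> i \<Longrightarrow> \<omega> \<in> space M \<Longrightarrow> 0 \<le> \<nu> i \<omega>"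
    and fin: "0 < \<theta>0" "cgf M (\<nu> 1) \<theta>0 < \<infinity>"
  shows "local_LDP M (S_proc \<nu> t) (Lambda_star (cgf M (\<nu> 1)) t)"
proof -
  define k where "k n = nat \<lfloor>real n * t\<rfloor>" for n
  define L where "L \<theta> = (\<integral>\<^sup>+\<omega>. ennreal (exp (\<theta> * \<nu> 1 \<omega>)) \<partial>M)" for \<theta>
  have cgf: "cgf M (\<nu> 1) \<theta> = ext_ln (L \<theta>)" for \<theta> by (simp add: cgf_def L_def)
  have \<nu>[measurable]: "\<nu> i \<in> borel_measurable M" if "1 \<le> i" for i
    using indep that by (auto simp: indep_vars_def)
  have L_pos: "L \<theta> \<noteq> 0" for \<theta>
    unfolding L_def by (subst nn_integral_0_iff_AE) (auto simp: ennreal_eq_0_iff not_le)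
  have cgf_real: "\<exists>a>0. L \<theta> = ennreal a \<and> cgf M (\<nu> 1) \<theta> = ereal (ln a)" if "cgf M (\<nu> 1) \<theta> \<noteq> \<infinity>" for \<theta>
  proof -
    have "L \<theta> \<noteq> \<top>" using that unfolding cgf by (auto simp: ext_ln_def)
    then obtain a where "0 \<le> a" "L \<theta> = ennreal a" by (cases "L \<theta>") auto
    moreover from this have "0 < a" using L_pos[of \<theta>] by (cases "a = 0") auto
    ultimately show ?thesis unfolding cgf by (auto simp: ext_ln_def)
  qed
  have kt: "(\<lambda>n. real (k n) / real n) \<longlonglongrightarrow> t"
    unfolding k_def using t by (intro tendsto_floor_ratio) simp
  have k_le: "real (k n) \<le> real n * t" for n using t by (simp add: k_def)
  have S: "S_proc \<nu> t n \<omega> = (\<Sum>i=1..k n. \<nu> i \<omega>) / real n" for n \<omega>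
    by (simp add: S_proc_def k_def)
  have meas: "S_proc \<nu> t n \<in> borel_measurable M" for n
    unfolding S[abs_def] by (intro borel_measurable_divide borel_measurable_sum \<nu>) auto
  have chernoff: "\<forall>\<^sub>F n in sequentially. prob {\<omega> \<in> space M. s < \<theta> * S_proc \<nu> t n \<omega>} \<le> exp (- (r * real n))"
    if "0 < a" "L \<theta> = ennreal a" "r < s - t * ln a" for \<theta> s a r
  proof -
    have "(\<lambda>n. (real (k n) / real n) * ln a - s) \<longlonglongrightarrow> t * ln a - s"
      by (intro tendsto_intros kt)
    then have "\<forall>\<^sub>F n in sequentially. (real (k n) / real n) * ln a - s < - r"
      by (rule order_tendstoD) (use that in simp)
    then show ?thesis
      using eventually_gt_at_top[of 0]
    proof eventually_elim
      case (elim n)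
      have "{\<omega> \<in> space M. s < \<theta> * S_proc \<nu> t n \<omega>} = {\<omega> \<in> space M. real n * s < \<theta> * (\<Sum>i=1..k n. \<nu> i \<omega>)}"
        using elim(2) by (simp add: S field_simps)
      then have "prob {\<omega> \<in> space M. s < \<theta> * S_proc \<nu> t n \<omega>} \<le> exp (- (real n * s)) * a ^ k n"
        using prob_sum_chernoff[OF indep distr, of a \<theta> "real n * s" "k n"] that by (simp add: L_def)
      also have "a ^ k n = exp (real (k n) * ln a)" using that by (simp add: exp_of_nat_mult)
      also have "exp (- (real n * s)) * exp (real (k n) * ln a) = exp (real (k n) * ln a - real n * s)"
        by (simp add: mult_exp_exp)
      also have "\<dots> \<le> exp (- (r * real n))" using elim by (simp add: field_simps)
      finally show ?case .
    qed
  qed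
  show ?thesis
    unfolding local_LDP_def
  proof (intro conjI allI impI)
    fix x r assume "ereal r < Lambda_star (cgf M (\<nu> 1)) t x"
    then obtain \<theta> where \<theta>: "ereal r < ereal (\<theta> * x) - ereal t * cgf M (\<nu> 1) \<theta>"
      unfolding Lambda_star_def by (auto simp: less_SUP_iff)
    \<comment> \<open>As \<open>t > 0\<close>, an infinite value would turn the difference into
      \<open>-\<infinity>\<close>.\<close>
    then have "cgf M (\<nu> 1) \<theta> \<noteq> \<infinity>" using t by auto
    from cgf_real[OF this] obtain a where a: "0 < a" "L \<theta> = ennreal a" "cgf M (\<nu> 1) \<theta> = ereal (ln a)"
      by blast
    have r: "r + t * ln a < \<theta> * x" using \<theta> a(3) by (simp add: algebra_simps)
    then obtain s where s: "r + t * ln a < s" "s < \<theta> * x" using dense by blast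
    have "\<forall>\<^sub>F n in sequentially. prob {\<omega> \<in> space M. S_proc \<nu> t n \<omega> \<in> {z. s < \<theta> * z}} \<le> exp (- (r * real n))"
      using chernoff[OF a(1,2), of r s] s by simp
    moreover have "open {z. s < \<theta> * z}" by (intro open_Collect_less continuous_intros)
    ultimately show "\<exists>A. open A \<and> x \<in> A \<and>
        (\<forall>\<^sub>F n in sequentially. prob {\<omega> \<in> space M. S_proc \<nu> t n \<omega> \<in> A} \<le> exp (- (r * real n)))"
      using s by (intro exI[of _ "{z. s < \<theta> * z}"]) auto
  next
    fix x r and A :: "real set"
    assume "Lambda_star (cgf M (\<nu> 1)) t x < ereal r" and A: "open A" "x \<in> A"
    from ereal_dense2[OF this(1)] obtain s where
      s: "Lambda_star (cgf M (\<nu> 1)) t x < ereal s" "ereal s < ereal r" by blast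
    \<comment> \<open>The step from \<open>s\<close> to \<open>s'\<close> gives
      \<open>q' < q\<close>; the step from \<open>s'\<close> to \<open>r\<close> absorbs the
      deviation of \<open>k n / n\<close> from \<open>t\<close>.\<close>
    obtain s' where s': "s < s'" "s' < r" using dense s(2) by auto
    obtain e where e: "0 < e" "ball x e \<subseteq> A" using A by (meson open_contains_ball)
    \<comment> \<open>About \<open>t * n\<close> variables are summed and divided by
      \<open>n\<close>, so their mean must be near \<open>x / t\<close>; likewise each carries the
      share \<open>s / t\<close> of the rate.\<close>
    define y where "y = x / t"
    define q where "q = exp (- (s / t))"
    define q' where "q' = exp (- (s' / t))"
    have q: "0 < q'" "q' < q" using s' t by (auto simp: q_def q'_def divide_strict_right_mono)
    have L_ge: "ennreal (exp (\<theta> * y) * q) \<le> L \<theta>" for \<theta>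
    proof (cases "cgf M (\<nu> 1) \<theta> = \<infinity>")
      case True
      then have "L \<theta> = \<top>" unfolding cgf by (auto simp: ext_ln_def split: if_splits)
      then show ?thesis by simp
    next
      case False
      from cgf_real[OF this] obtain a where a: "0 < a" "L \<theta> = ennreal a" "cgf M (\<nu> 1) \<theta> = ereal (ln a)"
        by blast
      have "ereal (\<theta> * x) - ereal t * cgf M (\<nu> 1) \<theta> \<le> Lambda_star (cgf M (\<nu> 1)) t x"
        unfolding Lambda_star_def by (rule SUP_upper) simp
      then have "ereal (\<theta> * x) - ereal t * cgf M (\<nu> 1) \<theta> < ereal s" using s(1) by (rule le_less_trans)
      then have "\<theta> * x - t * ln a < s" using a(3) by simp
      then have "\<theta> * y - s / t \<le> ln a" using t by (simp add: y_def field_simps)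
      then have "exp (\<theta> * y - s / t) \<le> a" using a(1) by (simp add: ln_ge_iff)
      then show ?thesis unfolding a(2) q_def by (intro ennreal_leI) (simp add: mult_exp_exp)
    qed
    have shift: "ennreal q \<le> (\<integral>\<^sup>+\<omega>. ennreal (exp (\<theta> * (\<nu> 1 \<omega> - y))) \<partial>M)" for \<theta>
    proof -
      have "ennreal q = ennreal (exp (- (\<theta> * y))) * ennreal (exp (\<theta> * y) * q)"
        using q by (simp add: ennreal_mult[symmetric] mult.assoc[symmetric] mult_exp_exp)
      also have "\<dots> \<le> ennreal (exp (- (\<theta> * y))) * L \<theta>"
        by (intro mult_left_mono L_ge) auto
      also have "\<dots> = (\<integral>\<^sup>+\<omega>. ennreal (exp (- (\<theta> * y))) * ennreal (exp (\<theta> * \<nu> 1 \<omega>)) \<partial>M)"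
        unfolding L_def by (rule nn_integral_cmult[symmetric]) measurable
      also have "\<dots> = (\<integral>\<^sup>+\<omega>. ennreal (exp (\<theta> * (\<nu> 1 \<omega> - y))) \<partial>M)"
        by (intro nn_integral_cong) (simp add: ennreal_mult[symmetric] mult_exp_exp algebra_simps)
      finally show ?thesis .
    qed
    \<comment> \<open>Half of the radius \<open>e\<close> is for the centred sum, the other half for
      the error \<open>(k n / n - t) * y\<close>.\<close>
    define \<delta> where "\<delta> = e / (2 * t)"
    have \<delta>: "0 < \<delta>" "t * \<delta> = e / 2" using e(1) t by (auto simp: \<delta>_def)
    have "\<forall>\<^sub>F m in sequentially. q' ^ m \<le> prob {\<omega> \<in> space M. \<bar>\<Sum>i=1..m. (\<nu> i \<omega> - y)\<bar> < real m * \<delta>}"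
      by (rule cramer_lower[OF indep_vars_shift[OF indep] distr_shift_cong[OF \<nu> \<nu> distr] q shift \<delta>(1)]) auto
    moreover have "filterlim k sequentially sequentially"
    proof -
      have "filterlim (\<lambda>n. real n * t) at_top sequentially"
        using t by (intro filterlim_at_top_mult_tendsto_pos[OF tendsto_const] filterlim_real_sequentially) auto
      then show ?thesis unfolding k_def
        by (intro filterlim_compose[OF filterlim_nat_sequentially] filterlim_compose[OF filterlim_floor_sequentially])
    qed
    ultimately have "\<forall>\<^sub>F n in sequentially. q' ^ k n \<le> prob {\<omega> \<in> space M. \<bar>\<Sum>i=1..k n. (\<nu> i \<omega> - y)\<bar> < real (k n) * \<delta>}"
      by (rule eventually_compose_filterlim)
    moreover have "\<forall>\<^sub>F n in sequentially. \<bar>real (k n) / real n - t\<bar> * \<bar>y\<bar> < e / 2"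
    proof -
      have "(\<lambda>n. \<bar>real (k n) / real n - t\<bar> * \<bar>y\<bar>) \<longlonglongrightarrow> \<bar>t - t\<bar> * \<bar>y\<bar>" by (intro tendsto_intros kt)
      then show ?thesis by (rule order_tendstoD) (use e in simp)
    qed
    moreover have "\<forall>\<^sub>F n in sequentially. (real (k n) / real n) * (s' / t) < r"
    proof -
      have "(\<lambda>n. (real (k n) / real n) * (s' / t)) \<longlonglongrightarrow> t * (s' / t)" by (intro tendsto_intros kt)
      then show ?thesis by (rule order_tendstoD) (use s' t in simp)
    qed
    ultimately show "\<forall>\<^sub>F n in sequentially. exp (- (r * real n)) \<le> prob {\<omega> \<in> space M. S_proc \<nu> t n \<omega> \<in> A}"
      using eventually_gt_at_top[of 0]
    proof eventually_elim
      case (elim n)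
      have "real (k n) * (s' / t) \<le> r * real n" using elim(3,4) t by (simp add: field_simps)
      then have "exp (- (r * real n)) \<le> exp (real (k n) * (- (s' / t)))" by simp
      also have "\<dots> = q' ^ k n" unfolding q'_def by (rule exp_of_nat_mult)
      also have "\<dots> \<le> prob {\<omega> \<in> space M. \<bar>\<Sum>i=1..k n. (\<nu> i \<omega> - y)\<bar> < real (k n) * \<delta>}" by (rule elim)
      also have "\<dots> \<le> prob {\<omega> \<in> space M. S_proc \<nu> t n \<omega> \<in> A}"
      proof (rule finite_measure_mono)
        have [measurable]: "S_proc \<nu> t n \<in> borel_measurable M" by (rule meas)
        have [measurable]: "A \<in> sets borel" using A by (intro borel_open)
        show "{\<omega> \<in> space M. S_proc \<nu> t n \<omega> \<in> A} \<in> events" by measurable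
        show "{\<omega> \<in> space M. \<bar>\<Sum>i=1..k n. (\<nu> i \<omega> - y)\<bar> < real (k n) * \<delta>} \<subseteq> {\<omega> \<in> space M. S_proc \<nu> t n \<omega> \<in> A}"
        proof (intro Collect_mono impI, elim conjE)
          fix \<omega> assume \<omega>: "\<omega> \<in> space M" "\<bar>\<Sum>i=1..k n. (\<nu> i \<omega> - y)\<bar> < real (k n) * \<delta>"
          define D where "D = (\<Sum>i=1..k n. (\<nu> i \<omega> - y))"
          have "(\<Sum>i=1..k n. \<nu> i \<omega>) = D + real (k n) * y" by (simp add: D_def sum_subtractf)
          moreover have "x = t * y" using t by (simp add: y_def)
          ultimately have eq: "S_proc \<nu> t n \<omega> - x = D / real n + (real (k n) / real n - t) * y"
            using elim(4) by (simp add: S field_simps)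
          have "real (k n) * \<delta> \<le> real n * t * \<delta>" using \<delta>(1) by (intro mult_right_mono k_le) simp
          then have "\<bar>D\<bar> \<le> real n * t * \<delta>" using \<omega>(2) unfolding D_def by linarith
          also have "real n * t * \<delta> = real n * (e / 2)" using \<delta>(2) by (simp add: mult.assoc)
          finally have "\<bar>D / real n\<bar> \<le> e / 2" using elim(4) by (simp add: field_simps)
          moreover have "\<bar>(real (k n) / real n - t) * y\<bar> < e / 2" using elim(2) by (simp add: abs_mult)
          moreover have "\<bar>u + v\<bar> < e" if "\<bar>u\<bar> \<le> e / 2" "\<bar>v\<bar> < e / 2" for u v :: real
            using that by linarith
          ultimately have "\<bar>S_proc \<nu> t n \<omega> - x\<bar> < e" unfolding eq by blast
          then have "S_proc \<nu> t n \<omega> \<in> ball x e" by (simp add: dist_real_def abs_minus_commute)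
          then show "\<omega> \<in> space M \<and> S_proc \<nu> t n \<omega> \<in> A" using \<omega>(1) e(2) by blast
        qed
      qed
      finally show ?case .
    qed
  next
    fix r
    from cgf_real[of \<theta>0] fin(2) obtain a where a: "0 < a" "L \<theta>0 = ennreal a" by auto
    \<comment> \<open>Solves \<open>\<theta>0 * c - t * ln a = r + 1\<close>, one unit above the
      required rate. As \<open>S_proc\<close> is nonnegative, leaving \<open>{0..c}\<close> means
      exceeding \<open>c\<close>.\<close>
    define c where "c = (r + 1 + t * ln a) / \<theta>0"
    have "\<theta>0 * c = r + 1 + t * ln a" using fin(1) by (simp add: c_def)
    then have "\<forall>\<^sub>F n in sequentially. prob {\<omega> \<in> space M. \<theta>0 * c < \<theta>0 * S_proc \<nu> t n \<omega>} \<le> exp (- (r * real n))"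
      by (intro chernoff[OF a]) simp
    moreover have "{\<omega> \<in> space M. \<theta>0 * c < \<theta>0 * S_proc \<nu> t n \<omega>} = {\<omega> \<in> space M. S_proc \<nu> t n \<omega> \<notin> {0..c}}" for n
    proof -
      have "0 \<le> S_proc \<nu> t n \<omega>" if "\<omega> \<in> space M" for \<omega>
        unfolding S using that nonneg by (intro divide_nonneg_nonneg sum_nonneg) auto
      then show ?thesis using fin(1) by auto
    qed
    ultimately show "\<exists>K. compact K \<and>
        (\<forall>\<^sub>F n in sequentially. prob {\<omega> \<in> space M. S_proc \<nu> t n \<omega> \<notin> K} \<le> exp (- (r * real n)))"
      by (intro exI[of _ "{0..c}"]) auto
  qed (rule meas)
qed

end

section \<open>The difference process\<close>

context prob_space
begin

text \<open>A finite rate would give every neighbourhood of \<open>x\<close> positive probability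
  for large \<open>n\<close>.\<close>

lemma local_LDP_eq_top:
  assumes Y: "local_LDP M Y I" and "open A" "x \<in> A" and out: "\<And>n \<omega>. \<omega> \<in> space M \<Longrightarrow> Y n \<omega> \<notin> A"
  shows "I x = \<infinity>"
proof (rule ccontr)
  assume "I x \<noteq> \<infinity>"
  then have "I x < \<infinity>" by simp
  from ereal_dense2[OF this] obtain r where "I x < ereal r" by blast
  from local_LDP_lower[OF Y this \<open>open A\<close> \<open>x \<in> A\<close>]
  have "\<forall>\<^sub>F n in sequentially. exp (- (r * real n)) \<le> prob {\<omega> \<in> space M. Y n \<omega> \<in> A}" .
  moreover have "{\<omega> \<in> space M. Y n \<omega> \<in> A} = {}" for n using out by blast
  ultimately have "\<forall>\<^sub>F n in sequentially. exp (- (r * real n)) \<le> 0" by simp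
  then show False by simp
qed

text \<open>Outside \<open>{0..1} \<times> {0..}\<close> the joint rate is infinite, so dropping these points does not change the
  infimum.\<close>

lemma J_rate_eq_INF:
  assumes T: "local_LDP M Y (\<lambda>x. if x \<in> {0..1} then I_rate t x else \<infinity>)"
    and S: "local_LDP M Z (Lambda_star \<phi> t)"
    and nonneg: "\<And>n \<omega>. \<omega> \<in> space M \<Longrightarrow> 0 \<le> Z n \<omega>"
  shows "J_rate \<phi> t y = (INF z\<in>{z. snd z - fst z = y}.
    case z of (x1, x2) \<Rightarrow> (if x1 \<in> {0..1} then I_rate t x1 else \<infinity>) + Lambda_star \<phi> t x2)"
    (is "_ = (INF z\<in>?C. ?g z)")
proof (rule antisym)
  show "J_rate \<phi> t y \<le> (INF z\<in>?C. ?g z)"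
  proof (rule INF_greatest)
    fix z assume "z \<in> ?C"
    then obtain x1 x2 where z: "z = (x1, x2)" "x2 = x1 + y" by (cases z) auto
    show "J_rate \<phi> t y \<le> ?g z"
    proof (cases "x1 \<in> {0..1} \<and> 0 \<le> x2")
      case True
      then show ?thesis unfolding J_rate_def z(1)
        by (intro INF_lower2[of "(x1, x2)"]) (use z in auto)
    next
      case False
      \<comment> \<open>Read off from the large deviation bounds, not from the supremum:
        \<open>Z\<close> never takes negative values.\<close>
      have "Lambda_star \<phi> t x2 = \<infinity>" if "x2 < 0"
        by (rule local_LDP_eq_top[OF S, of "{..<0}"]) (use that nonneg in \<open>auto simp: not_less\<close>)
      moreover have "0 \<le> Lambda_star \<phi> t x2" by (rule local_LDP_nonneg[OF S])
      moreover have "0 \<le> (if x1 \<in> {0..1} then I_rate t x1 else \<infinity>)" by (rule local_LDP_nonneg[OF T])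
      ultimately have "?g z = \<infinity>" using False z by (cases "x1 \<in> {0..1}") auto
      then show ?thesis by simp
    qed
  qed
  show "(INF z\<in>?C. ?g z) \<le> J_rate \<phi> t y"
    unfolding J_rate_def
  proof (rule INF_greatest)
    fix z assume z: "z \<in> {(x1, x2) \<in> {0..1} \<times> {0..}. x2 = x1 + y}"
    then have "z \<in> ?C" by auto
    then have "(INF z\<in>?C. ?g z) \<le> ?g z" by (rule INF_lower)
    also have "?g z = (case z of (x1, x2) \<Rightarrow> I_rate t x1 + Lambda_star \<phi> t x2)" using z by auto
    finally show "(INF z\<in>?C. ?g z) \<le> (case z of (x1, x2) \<Rightarrow> I_rate t x1 + Lambda_star \<phi> t x2)" .
  qed
qed

end

theorem proposition3p1:
  fixes M :: "'a measure"
    and U :: "nat \<Rightarrow> nat \<Rightarrow> 'a \<Rightarrow> real"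
    and \<nu> :: "nat \<Rightarrow> 'a \<Rightarrow> real"
    and t \<mu> :: real
  assumes "prob_space M"
    and "0 < t" and "t \<le> 1"
    and "\<And>n. 1 \<le> n \<Longrightarrow> prob_space.indep_vars M (\<lambda>_. borel) (U n) {1..n}"
    and "\<And>n i. 1 \<le> n \<Longrightarrow> i \<in> {1..n} \<Longrightarrow>
           distr M borel (U n i) = uniform_measure lborel {0..1}"
    and "prob_space.indep_vars M (\<lambda>_. borel) \<nu> {1..}"
    and "\<And>i. 1 \<le> i \<Longrightarrow> distr M borel (\<nu> i) = distr M borel (\<nu> 1)"
    and "\<And>n. 1 \<le> n \<Longrightarrow>
           prob_space.indep_var M
             (Pi\<^sub>M {1..n} (\<lambda>_. borel)) (\<lambda>\<omega>. \<lambda>k\<in>{1..n}. order_stat (\<lambda>i. U n i \<omega>) n k)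
             (Pi\<^sub>M {1..} (\<lambda>_. borel)) (\<lambda>\<omega>. \<lambda>i\<in>{1..}. \<nu> i \<omega>)"
    and "\<And>i \<omega>. 1 \<le> i \<Longrightarrow> \<omega> \<in> space M \<Longrightarrow> 0 \<le> \<nu> i \<omega>"
    and "measure M {\<omega> \<in> space M. 0 < \<nu> 1 \<omega>} = 1"
    and "0 < \<mu>" and "integrable M (\<nu> 1)" and "integral\<^sup>L M (\<nu> 1) = 1 / \<mu>"
    and "0 \<in> interior {\<theta>. cgf M (\<nu> 1) \<theta> < \<infinity>}"
  shows "good_rate_function (J_rate (cgf M (\<nu> 1)) t) \<and>
         satisfies_LDP M (X_proc U \<nu> t) (J_rate (cgf M (\<nu> 1)) t)"
proof -
  interpret prob_space M by fact
  have "\<exists>e>0. ball 0 e \<subseteq> {\<theta>. cgf M (\<nu> 1) \<theta> < \<infinity>}"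
    using assms(14) by (simp only: mem_interior)
  then obtain e where e: "0 < e" "ball 0 e \<subseteq> {\<theta>. cgf M (\<nu> 1) \<theta> < \<infinity>}" by blast
  \<comment> \<open>A positive argument with finite generating function, as needed for exponential
    tightness of the sums.\<close>
  have "e / 2 \<in> ball 0 e" using e(1) by simp
  from subsetD[OF e(2) this] have fin: "cgf M (\<nu> 1) (e / 2) < \<infinity>" by (rule CollectD)
  have "0 < e / 2" using e(1) by simp
  have T: "local_LDP M (T_proc U t) (\<lambda>x. if x \<in> {0..1} then I_rate t x else \<infinity>)"
    by (rule local_LDP_T_proc[OF assms(2-5)])
  have S: "local_LDP M (S_proc \<nu> t) (Lambda_star (cgf M (\<nu> 1)) t)"
    by (rule local_LDP_S_proc[OF assms(2,6,7,9) \<open>0 < e / 2\<close> fin])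
  have indep: "indep_var borel (T_proc U t n) borel (S_proc \<nu> t n)" if "1 \<le> n" for n
  proof -
    define k where "k = nat \<lfloor>real n * t\<rfloor>"
    have "k \<le> n" unfolding k_def using assms(3) by (rule nat_floor_mult_le)
    \<comment> \<open>Independence is given for the vector of order statistics and the whole
      sequence of summands; \<open>f\<close> and \<open>g\<close> are the measurable maps producing
      \<open>T_proc\<close> and \<open>S_proc\<close> from them. The vector has no entry 0, hence
      the case \<open>k = 0\<close>.\<close>
    define f where "f v = (if k = 0 then 0 else v k)" for v :: "nat \<Rightarrow> real"
    define g where "g w = (1 / real n) * (\<Sum>i = 1..k. w i)" for w :: "nat \<Rightarrow> real"
    have "f \<in> borel_measurable (Pi\<^sub>M {1..n} (\<lambda>_. borel))"
      unfolding f_def[abs_def] using \<open>k \<le> n\<close>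
      by (cases "k = 0") (auto intro!: measurable_component_singleton)
    moreover have "g \<in> borel_measurable (Pi\<^sub>M {1..} (\<lambda>_. borel))"
      unfolding g_def[abs_def]
      by (intro borel_measurable_times borel_measurable_const borel_measurable_sum
          measurable_component_singleton) auto
    ultimately have "indep_var borel (f \<circ> (\<lambda>\<omega>. \<lambda>k\<in>{1..n}. order_stat (\<lambda>i. U n i \<omega>) n k))
        borel (g \<circ> (\<lambda>\<omega>. \<lambda>i\<in>{1..}. \<nu> i \<omega>))"
      by (rule indep_var_compose[OF assms(8)[OF that]])
    moreover have "f \<circ> (\<lambda>\<omega>. \<lambda>k\<in>{1..n}. order_stat (\<lambda>i. U n i \<omega>) n k) = T_proc U t n"
      using \<open>k \<le> n\<close> by (auto simp: fun_eq_iff f_def T_proc_def order_stat_def simp flip: k_def)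
    moreover have "g \<circ> (\<lambda>\<omega>. \<lambda>i\<in>{1..}. \<nu> i \<omega>) = S_proc \<nu> t n"
      by (auto simp: fun_eq_iff g_def S_proc_def simp flip: k_def)
    ultimately show ?thesis by simp
  qed
  have S_nonneg: "0 \<le> S_proc \<nu> t n \<omega>" if "\<omega> \<in> space M" for n \<omega>
    unfolding S_proc_def using assms(9) that by (intro mult_nonneg_nonneg sum_nonneg) auto
  have "continuous_on UNIV (\<lambda>z :: real \<times> real. snd z - fst z)" by (intro continuous_intros)
  note local_LDP_contraction[OF local_LDP_Pair[OF T S indep] this]
  moreover have "J_rate (cgf M (\<nu> 1)) t = (\<lambda>y. INF z\<in>{z. snd z - fst z = y}.
      case z of (x1, x2) \<Rightarrow> (if x1 \<in> {0..1} then I_rate t x1 else \<infinity>) + Lambda_star (cgf M (\<nu> 1)) t x2)"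
    by (rule ext, rule J_rate_eq_INF[OF T S S_nonneg])
  moreover have "X_proc U \<nu> t = (\<lambda>n \<omega>. snd (T_proc U t n \<omega>, S_proc \<nu> t n \<omega>) - fst (T_proc U t n \<omega>, S_proc \<nu> t n \<omega>))"
    by (simp add: fun_eq_iff X_proc_def)
  ultimately have "local_LDP M (X_proc U \<nu> t) (J_rate (cgf M (\<nu> 1)) t)"
    by (simp only:)
  then show ?thesis
    by (simp only: local_LDP_imp_good_rate_function local_LDP_imp_satisfies_LDP)
qed

end
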